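(* Let $X$ be a Banach space and let $J \subset \mathscr{L}(X)$ be a separable admissible Banach ideal. Let $T \in \mathscr{L}(X)$. If the adjoint $T^* \in \mathscr{L}(X^* )$ is an extended backward shift, then the generalised derivations $L_I - R_{-T} \colon J \to J$ and $L_I - R_{-T'} \colon J \to J$ satisfy the Hypercyclicity Criterion on $J$, where $T' = \sum_{j=1}^\infty \frac{1}{j!} T^j$.
   Context: $\mathscr{L}(X)$ is the space of bounded linear operators on $X$, and $I$ is the identity operator on $X$. For $A,B \in \mathscr{L}(X)$, $L_A(S) = AS$ and $R_B(S) = SB$ are the left and right multiplication operators, and the generalised derivation is $\tau_{A,B} = L_A - R_B$, i.e. $\tau_{A,B}(S) = AS - SB$; these are considered as bounded operators on $J$. Banach ideal: $(J, \lVert\cdot\rVert_J)$ is a Banach ideal of $\mathscr{L}(X)$ if (i) $J \subset \mathscr{L}(X)$ is a linear subspace; (ii) the norm $\lVert\cdot\rVert_J$ is complete in $J$ and $\lVert S\rVert \le \lVert S\rVert_J$ for all $S \in J$; (iii) $BSA \in J$ and $\lVert BSA\rVert_J \le \lVert B\rVert\,\lVert A\rVert\,\lVert S\rVert_J$ for all $A,B \in \mathscr{L}(X)$, $S \in J$; (iv) the rank one operators $x^*\otimes x \colon z \mapsto x^*(z)x$ belong to $J$ and $\lVert x^*\otimes x\rVert_J = \lVert x^*\rVert\,\lVert x\rVert$ for all $x^* \in X^*$, $x \in X$. It is admissible if the finite rank operators $\mathscr{F}(X) = \mathrm{span}\{x^*\otimes x : x^*\in X^*, x \in X\}$ are dense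 in $(J, \lVert\cdot\rVert_J)$. Separability of $J$ is with respect to $\lVert\cdot\rVert_J$. Extended backward shift: an operator $V \in \mathscr{L}(Y)$ on a Banach space $Y$ such that $\mathrm{span}\left(\bigcup_{j=0}^\infty \left(\ker V^j \cap \operatorname{ran} V^j\right)\right)$ is dense in $Y$ (here applied to $V = T^*$, $Y = X^*$ with the norm topology). Hypercyclicity Criterion: a bounded operator $U$ on a separable Banach space $Y$ satisfies the Hypercyclicity Criterion if there exist a dense linear subspace $Y_0 \subset Y$, an increasing sequence $(n_k)$ of positive integers and linear maps $S_{n_k} \colon Y_0 \to Y$, $k \ge 1$, such that for every $y \in Y_0$, as $k \to \infty$: $U^{n_k} y \to 0$, $S_{n_k} y \to 0$, and $U^{n_k} S_{n_k} y \to y$. *)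

theory Defs
  imports "HOL-Analysis.Analysis"
begin

section \<open>Normed spaces over a scalar field, with explicit carrier and norm\<close>

text \<open>
  The scalars range over a complete \<^class>\<open>real_normed_field\<close>, so real and complex Banach spaces
  are treated at once (up to isomorphism there are no other such fields). A Banach ideal carries
  a norm of its own, and over complex scalars the dual space and the space of operators are proper
  subspaces of the types of bounded real-linear maps; hence normed spaces are given by a carrier
  \<open>Y\<close> and a norm \<open>nrm\<close> inside an ambient vector space.
\<close>

text \<open>The value outside \<open>Y\<close> is irrelevant; \<^locale>\<open>Metric_space\<close> wants it symmetric and nonnegative.\<close>

definition norm_dist :: "'v::ab_group_add set \<Rightarrow> ('v \<Rightarrow> real) \<Rightarrow> 'v \<Rightarrow> 'v \<Rightarrow> real" where
  "norm_dist Y nrm x y = (if x \<in> Y \<and> y \<in> Y then nrm (x - y) else 0)"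

definition norm_topology :: "'v::ab_group_add set \<Rightarrow> ('v \<Rightarrow> real) \<Rightarrow> 'v topology" where
  "norm_topology Y nrm = Metric_space.mtopology Y (norm_dist Y nrm)"

locale normed_space_on = vector_space smul
  for smul :: "'k::real_normed_field \<Rightarrow> 'v::ab_group_add \<Rightarrow> 'v" +
  fixes Y :: "'v set" and nrm :: "'v \<Rightarrow> real"
  assumes subspace_carrier: "subspace Y"
    and nrm_nonneg: "x \<in> Y \<Longrightarrow> 0 \<le> nrm x"
    and nrm_eq_0_iff: "x \<in> Y \<Longrightarrow> nrm x = 0 \<longleftrightarrow> x = 0"
    and nrm_scale: "x \<in> Y \<Longrightarrow> nrm (smul c x) = norm c * nrm x"
    and nrm_triangle: "x \<in> Y \<Longrightarrow> y \<in> Y \<Longrightarrow> nrm (x + y) \<le> nrm x + nrm y"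
begin

lemma Metric_space_norm_dist: "Metric_space Y (norm_dist Y nrm)"
proof
  fix x y z
  have sym: "nrm (y - x) = nrm (x - y)" if "x \<in> Y" "y \<in> Y" for x y
    using nrm_scale[of "x - y" "- 1"] that by (simp add: subspace_diff[OF subspace_carrier])
  show "0 \<le> norm_dist Y nrm x y"
    by (simp add: norm_dist_def nrm_nonneg subspace_diff[OF subspace_carrier])
  show "norm_dist Y nrm x y = norm_dist Y nrm y x"
    using sym[of x y] by (simp add: norm_dist_def)
  show "norm_dist Y nrm x y = 0 \<longleftrightarrow> x = y" if "x \<in> Y" "y \<in> Y"
    using that by (simp add: norm_dist_def nrm_eq_0_iff subspace_diff[OF subspace_carrier])
  show "norm_dist Y nrm x z \<le> norm_dist Y nrm x y + norm_dist Y nrm y z"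
    if "x \<in> Y" "y \<in> Y" "z \<in> Y"
    using that nrm_triangle[of "x - y" "y - z"]
    by (simp add: norm_dist_def subspace_diff[OF subspace_carrier])
qed

lemma topspace_norm_topology [simp]: "topspace (norm_topology Y nrm) = Y"
  by (simp add: norm_topology_def Metric_space.topspace_mtopology[OF Metric_space_norm_dist])

end

locale banach_space_on = normed_space_on +
  assumes complete: "Metric_space.mcomplete Y (norm_dist Y nrm)"

definition linear_map_on ::
    "('k::field \<Rightarrow> 'v::ab_group_add \<Rightarrow> 'v) \<Rightarrow> 'v set \<Rightarrow> 'v set \<Rightarrow> ('v \<Rightarrow> 'v) \<Rightarrow> bool" where
  "linear_map_on smul Y Z U \<longleftrightarrow>
     U \<in> Y \<rightarrow> Z \<and>
     (\<forall>x\<in>Y. \<forall>y\<in>Y. U (x + y) = U x + U y) \<and>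
     (\<forall>c. \<forall>x\<in>Y. U (smul c x) = smul c (U x))"

definition bounded_operator_on ::
    "('k::field \<Rightarrow> 'v::ab_group_add \<Rightarrow> 'v) \<Rightarrow> 'v set \<Rightarrow> ('v \<Rightarrow> real) \<Rightarrow> ('v \<Rightarrow> 'v) \<Rightarrow> bool" where
  "bounded_operator_on smul Y nrm U \<longleftrightarrow>
     linear_map_on smul Y Y U \<and> (\<exists>K. \<forall>x\<in>Y. nrm (U x) \<le> K * nrm x)"

definition extended_backward_shift ::
    "('k::real_normed_field \<Rightarrow> 'v::ab_group_add \<Rightarrow> 'v) \<Rightarrow> 'v set \<Rightarrow> ('v \<Rightarrow> real) \<Rightarrow> ('v \<Rightarrow> 'v) \<Rightarrow> bool"
  where
  "extended_backward_shift smul Y nrm V \<longleftrightarrow>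
     banach_space_on smul Y nrm \<and> bounded_operator_on smul Y nrm V \<and>
     norm_topology Y nrm closure_of
       module.span smul (\<Union>j. {y \<in> Y. (V ^^ j) y = 0} \<inter> (V ^^ j) ` Y) = Y"

text \<open>Only the maps \<open>S (n k)\<close> matter.\<close>

definition hypercyclicity_criterion ::
    "('k::real_normed_field \<Rightarrow> 'v::ab_group_add \<Rightarrow> 'v) \<Rightarrow> 'v set \<Rightarrow> ('v \<Rightarrow> real) \<Rightarrow> ('v \<Rightarrow> 'v) \<Rightarrow> bool"
  where
  "hypercyclicity_criterion smul Y nrm U \<longleftrightarrow>
     banach_space_on smul Y nrm \<and> separable_space (norm_topology Y nrm) \<and>
     bounded_operator_on smul Y nrm U \<and>
     (\<exists>Y0 (n :: nat \<Rightarrow> nat) S.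
        module.subspace smul Y0 \<and> Y0 \<subseteq> Y \<and> norm_topology Y nrm closure_of Y0 = Y \<and>
        strict_mono n \<and> (\<forall>k. 0 < n k) \<and>
        (\<forall>k. linear_map_on smul Y0 Y (S (n k))) \<and>
        (\<forall>y\<in>Y0.
           limitin (norm_topology Y nrm) (\<lambda>k. (U ^^ n k) y) 0 sequentially \<and>
           limitin (norm_topology Y nrm) (\<lambda>k. S (n k) y) 0 sequentially \<and>
           limitin (norm_topology Y nrm) (\<lambda>k. (U ^^ n k) (S (n k) y)) y sequentially))"


section \<open>Banach spaces, their duals and their operators\<close>

text \<open>
  The type class already provides completeness and a real structure, which the scalar
  multiplication has to extend.
\<close>

locale scalar_banach_space = normed_space_on smul UNIV norm
  for smul :: "'k::{real_normed_field,banach} \<Rightarrow> 'a::banach \<Rightarrow> 'a" +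
  assumes scale_of_real: "smul (of_real r) x = r *\<^sub>R x"

text \<open>
  \<^typ>\<open>'a \<Rightarrow>\<^sub>L 'b\<close> consists of the bounded real-linear maps, among which the following
  are the linear ones; its norm is the operator norm.
\<close>

definition bounded_linear_maps ::
    "('k::field \<Rightarrow> 'a::real_normed_vector \<Rightarrow> 'a) \<Rightarrow> ('k \<Rightarrow> 'b::real_normed_vector \<Rightarrow> 'b) \<Rightarrow> ('a \<Rightarrow>\<^sub>L 'b) set"
  where
  "bounded_linear_maps sA sB = {f. Vector_Spaces.linear sA sB (blinfun_apply f)}"

abbreviation operators :: "('k::field \<Rightarrow> 'a::real_normed_vector \<Rightarrow> 'a) \<Rightarrow> ('a \<Rightarrow>\<^sub>L 'a) set" where
  "operators smul \<equiv> bounded_linear_maps smul smul"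

abbreviation dual :: "('k::real_normed_field \<Rightarrow> 'a::real_normed_vector \<Rightarrow> 'a) \<Rightarrow> ('a \<Rightarrow>\<^sub>L 'k) set" where
  "dual smul \<equiv> bounded_linear_maps smul (*)"

definition map_scale ::
    "('k \<Rightarrow> 'b::real_normed_vector \<Rightarrow> 'b) \<Rightarrow> 'k \<Rightarrow> ('a::real_normed_vector \<Rightarrow>\<^sub>L 'b) \<Rightarrow> ('a \<Rightarrow>\<^sub>L 'b)" where
  "map_scale sB c f = Blinfun (\<lambda>x. sB c (f x))"

definition rank_one ::
    "('k \<Rightarrow> 'a::real_normed_vector \<Rightarrow> 'a) \<Rightarrow> ('a \<Rightarrow>\<^sub>L 'k::real_normed_field) \<Rightarrow> 'a \<Rightarrow> ('a \<Rightarrow>\<^sub>L 'a)" where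
  "rank_one smul f x = Blinfun (\<lambda>z. smul (f z) x)"

definition finite_rank_operators ::
    "('k::real_normed_field \<Rightarrow> 'a::real_normed_vector \<Rightarrow> 'a) \<Rightarrow> ('a \<Rightarrow>\<^sub>L 'a) set" where
  "finite_rank_operators smul =
     module.span (map_scale smul) {rank_one smul f x | f x. f \<in> dual smul}"

definition dual_adjoint ::
    "('a::real_normed_vector \<Rightarrow>\<^sub>L 'a) \<Rightarrow> ('a \<Rightarrow>\<^sub>L 'k::real_normed_vector) \<Rightarrow> ('a \<Rightarrow>\<^sub>L 'k)" where
  "dual_adjoint T f = f o\<^sub>L T"

definition blinfun_pow :: "('a::real_normed_vector \<Rightarrow>\<^sub>L 'a) \<Rightarrow> nat \<Rightarrow> ('a \<Rightarrow>\<^sub>L 'a)" where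
  "blinfun_pow T j = (((o\<^sub>L) T) ^^ j) id_blinfun"

definition left_mult :: "('a::real_normed_vector \<Rightarrow>\<^sub>L 'a) \<Rightarrow> ('a \<Rightarrow>\<^sub>L 'a) \<Rightarrow> ('a \<Rightarrow>\<^sub>L 'a)" where
  "left_mult A S = A o\<^sub>L S"

definition right_mult :: "('a::real_normed_vector \<Rightarrow>\<^sub>L 'a) \<Rightarrow> ('a \<Rightarrow>\<^sub>L 'a) \<Rightarrow> ('a \<Rightarrow>\<^sub>L 'a)" where
  "right_mult B S = S o\<^sub>L B"

definition generalised_derivation ::
    "('a::real_normed_vector \<Rightarrow>\<^sub>L 'a) \<Rightarrow> ('a \<Rightarrow>\<^sub>L 'a) \<Rightarrow> ('a \<Rightarrow>\<^sub>L 'a) \<Rightarrow> ('a \<Rightarrow>\<^sub>L 'a)" where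
  "generalised_derivation A B S = left_mult A S - right_mult B S"

lemma scalar_banach_space_field:
  "scalar_banach_space ((*) :: 'k::{real_normed_field,banach} \<Rightarrow> 'k \<Rightarrow> 'k)"
  by unfold_locales
    (simp_all add: algebra_simps vector_space_over_itself.subspace_UNIV norm_mult
      norm_triangle_ineq scaleR_conv_of_real)

context scalar_banach_space
begin

lemma banach_space_on_UNIV: "banach_space_on smul UNIV norm"
proof -
  have "norm_dist UNIV norm = (dist :: 'a \<Rightarrow> 'a \<Rightarrow> real)"
    by (simp add: fun_eq_iff norm_dist_def dist_norm)
  moreover have "Met_TC.mcomplete TYPE('a)"
    by (simp add: complete_UNIV)
  ultimately show ?thesis
    by unfold_locales simp
qed

lemma bounded_linear_scale_left: "bounded_linear (\<lambda>c. smul c x)"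
proof (rule bounded_linear_intro[where K = "norm x"])
  show "smul (r *\<^sub>R c) x = r *\<^sub>R smul c x" for r c
    by (simp add: scaleR_conv_of_real scale_of_real flip: scale_scale)
qed (simp_all add: scale_left_distrib nrm_scale)

lemma bounded_linear_scale_right: "bounded_linear (smul c)"
proof (rule bounded_linear_intro[where K = "norm c"])
  show "smul c (r *\<^sub>R x) = r *\<^sub>R smul c x" for r x
    by (simp add: mult.commute flip: scale_of_real)
qed (simp_all add: scale_right_distrib nrm_scale mult.commute)

lemma map_scale_apply [simp]: "blinfun_apply (map_scale smul c f) z = smul c (f z)"
  unfolding map_scale_def
  by (subst bounded_linear_Blinfun_apply)
    (auto intro: bounded_linear_compose[OF bounded_linear_scale_right blinfun.bounded_linear_right])

lemma rank_one_apply [simp]: "blinfun_apply (rank_one smul f x) z = smul (f z) x"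
  unfolding rank_one_def
  by (subst bounded_linear_Blinfun_apply)
    (auto intro: bounded_linear_compose[OF bounded_linear_scale_left blinfun.bounded_linear_right])

lemma vector_space_map_scale:
  "vector_space (map_scale smul :: 'k \<Rightarrow> ('b::real_normed_vector \<Rightarrow>\<^sub>L 'a) \<Rightarrow> _)"
  by unfold_locales
    (auto intro!: blinfun_eqI simp: blinfun.add_left scale_left_distrib scale_right_distrib)

lemma norm_map_scale: "norm (map_scale smul c f) = norm c * norm f"
proof (cases "c = 0")
  case True
  then have "map_scale smul c f = 0" by (auto intro!: blinfun_eqI)
  then show ?thesis using True by simp
next
  case False
  have le: "norm (map_scale smul c f) \<le> norm c * norm f" for c f
    by (rule norm_blinfun_bound)
      (simp_all add: nrm_scale mult.assoc mult_left_mono norm_blinfun)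
  have "norm f = norm (map_scale smul (inverse c) (map_scale smul c f))"
    using False by (auto intro!: arg_cong[where f = norm] blinfun_eqI)
  also have "\<dots> \<le> inverse (norm c) * norm (map_scale smul c f)"
    using le[of "inverse c" "map_scale smul c f"] by (simp add: norm_inverse)
  finally have "norm c * norm f \<le> norm (map_scale smul c f)"
    using False by (simp add: field_simps)
  then show ?thesis using le[of c f] by simp
qed

text \<open>The spaces of operators and functionals are Banach spaces for the operator norm.\<close>

lemma banach_space_on_bounded_linear_maps:
  fixes sB :: "'k \<Rightarrow> 'b::real_normed_vector \<Rightarrow> 'b"
  assumes "vector_space sB"
  shows "banach_space_on (map_scale smul) (bounded_linear_maps sB smul) norm"
proof -
  interpret ms: vector_space "map_scale smul :: 'k \<Rightarrow> ('b \<Rightarrow>\<^sub>L 'a) \<Rightarrow> _"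
    by (rule vector_space_map_scale)
  interpret B: vector_space sB by fact
  have iff: "f \<in> bounded_linear_maps sB smul \<longleftrightarrow> (\<forall>c z. f (sB c z) = smul c (f z))" for f
    unfolding bounded_linear_maps_def mem_Collect_eq Vector_Spaces.linear_iff
    using assms vector_space_axioms by (auto simp: blinfun.add_right)
  let ?L = "bounded_linear_maps sB smul"
  have sub: "ms.subspace ?L"
    by (rule ms.subspaceI)
      (auto simp: iff blinfun.add_left scale_right_distrib mult.commute)
  interpret N: normed_space_on "map_scale smul" ?L norm
    by unfold_locales (simp_all add: sub norm_map_scale norm_triangle_ineq)
  interpret M: Metric_space ?L "norm_dist ?L norm"
    by (rule N.Metric_space_norm_dist)
  have closed: "closed ?L"
  proof -
    have "?L = (\<Inter>c z. {f. blinfun_apply f (sB c z) = smul c (blinfun_apply f z)})"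
      by (auto simp: iff)
    also have "closed \<dots>"
      by (intro closed_INT ballI closed_Collect_eq continuous_intros
          bounded_linear.continuous_on[OF bounded_linear_scale_right])
    finally show ?thesis .
  qed
  show ?thesis
  proof
    show M.mcomplete
      unfolding M.mcomplete_def
    proof (intro allI impI)
      fix \<sigma> assume \<sigma>: "M.MCauchy \<sigma>"
      then have inL: "\<sigma> n \<in> ?L" for n by (auto simp: M.MCauchy_def)
      have "Cauchy \<sigma>"
        using \<sigma> inL by (auto simp: M.MCauchy_def Cauchy_def norm_dist_def dist_norm)
      then obtain l where l: "\<sigma> \<longlonglongrightarrow> l"
        by (auto simp: Cauchy_convergent_iff convergent_def)
      have "l \<in> ?L" using closed_sequentially[OF closed inL l] .
      moreover have "\<forall>e>0. \<forall>\<^sub>F n in sequentially. norm (\<sigma> n - l) < e"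
        using l by (auto simp: tendsto_iff dist_norm)
      ultimately have "limitin M.mtopology \<sigma> l sequentially"
        using inL by (simp add: M.limitin_metric norm_dist_def)
      then show "\<exists>l. limitin M.mtopology \<sigma> l sequentially" ..
    qed
  qed
qed

lemma banach_space_on_dual: "banach_space_on (map_scale (*)) (dual smul) norm"
  using scalar_banach_space.banach_space_on_bounded_linear_maps
    [OF scalar_banach_space_field vector_space_axioms] .

end

text \<open>Summability makes \<open>\<Sum>j. (1 / fact (Suc j)) *\<^sub>R blinfun_pow T (Suc j)\<close> the genuine limit in operator norm.\<close>

lemma summable_blinfun_pow:
  fixes T :: "'a::banach \<Rightarrow>\<^sub>L 'a"
  shows "summable (\<lambda>j. (1 / fact (Suc j)) *\<^sub>R blinfun_pow T (Suc j))"
proof -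
  have norm_pow: "norm (blinfun_pow T j) \<le> norm T ^ j" for j
  proof (induction j)
    case 0 show ?case by (simp add: blinfun_pow_def norm_blinfun_id_le)
  next
    case (Suc j)
    have "norm (blinfun_pow T (Suc j)) \<le> norm T * norm (blinfun_pow T j)"
      by (simp add: blinfun_pow_def norm_blinfun_compose)
    also have "\<dots> \<le> norm T * norm T ^ j" by (simp add: Suc mult_left_mono)
    finally show ?case by simp
  qed
  have "summable (\<lambda>j. (1 / fact j) *\<^sub>R blinfun_pow T j)"
  proof (rule summable_comparison_test')
    show "summable (\<lambda>j. norm T ^ j /\<^sub>R fact j)" by (rule summable_exp_generic)
    show "norm ((1 / fact j) *\<^sub>R blinfun_pow T j) \<le> norm T ^ j /\<^sub>R fact j" if "j \<ge> 0" for j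
      using norm_pow[of j] by (simp add: field_simps)
  qed
  then show ?thesis by (subst summable_Suc_iff)
qed


section \<open>Banach ideals\<close>

locale banach_ideal = scalar_banach_space smul
  for smul :: "'k::{real_normed_field,banach} \<Rightarrow> 'a::banach \<Rightarrow> 'a" +
  fixes J :: "('a \<Rightarrow>\<^sub>L 'a) set" and normJ :: "('a \<Rightarrow>\<^sub>L 'a) \<Rightarrow> real"
  assumes ideal_subset: "J \<subseteq> operators smul"
    and ideal_banach: "banach_space_on (map_scale smul) J normJ"
    and norm_le_normJ: "S \<in> J \<Longrightarrow> norm S \<le> normJ S"
    and ideal_mult: "A \<in> operators smul \<Longrightarrow> B \<in> operators smul \<Longrightarrow> S \<in> J \<Longrightarrow>
      B o\<^sub>L S o\<^sub>L A \<in> J"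
    and normJ_mult: "A \<in> operators smul \<Longrightarrow> B \<in> operators smul \<Longrightarrow> S \<in> J \<Longrightarrow>
      normJ (B o\<^sub>L S o\<^sub>L A) \<le> norm B * norm A * normJ S"
    and rank_one_in_ideal: "f \<in> dual smul \<Longrightarrow> rank_one smul f x \<in> J"
    and normJ_rank_one: "f \<in> dual smul \<Longrightarrow> normJ (rank_one smul f x) = norm f * norm x"

locale admissible_banach_ideal = banach_ideal +
  assumes finite_rank_dense: "norm_topology J normJ closure_of finite_rank_operators smul = J"

end

theory Submission
  imports Defs
begin

text \<open>
  Since \<open>L_I - R_{-A}\<close> maps \<open>S\<close> to \<open>S + S A\<close>, it sends a rank one operator \<open>h \<otimes> x\<close> to
  \<open>(W h) \<otimes> x\<close>, where \<open>W = I + A*\<close>. For \<open>A = T\<close> this is \<open>W = I + T*\<close>, for \<open>A = T'\<close> it is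
  \<open>W = exp (T*)\<close>. On the generalised kernel of \<open>V = T*\<close> both are of the form \<open>E (V)\<close> for the power
  series \<open>E = exp (L)\<close> with \<open>L = ln (1 + X)\<close> or \<open>L = X\<close>, and this is all that distinguishes
  the two cases.

  The heart of the matter is finite-dimensional. Let \<open>f = V^j g\<close> with \<open>V^j f = 0\<close> and \<open>j > 0\<close>; then
  \<open>V^(2j) g = 0\<close>, so power series in \<open>V\<close> act on \<open>g\<close> modulo \<open>X^(2j)\<close>. Pade approximation
  gives polynomials \<open>b\<close> of degree less than \<open>j\<close> and \<open>p\<close> monic of degree \<open>j\<close> with
  \<open>exp (X) b (X) = p (X)\<close> modulo \<open>X^(2j)\<close>. Replacing \<open>X\<close> by \<open>t X\<close> and dividing by \<open>t^j\<close>
  yields, as \<open>t\<close> tends to plus or minus infinity, series tending to \<open>0\<close> that \<open>exp (t X)\<close> carries to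
  series tending to \<open>X^j\<close>. Taking \<open>t = n\<close> and \<open>t = - n\<close> and substituting \<open>L\<close> for \<open>X\<close>, one
  obtains \<open>b_n \<rightarrow> 0\<close> with \<open>W^n b_n \<rightarrow> f\<close>, and \<open>c_n \<rightarrow> f\<close> with \<open>W^n c_n \<rightarrow> 0\<close>
  (\<open>exp_power_transfer\<close>, \<open>rank_one_kernel_range_mixing\<close>).

  The vectors admitting such approximations form a closed subspace. Because \<open>T*\<close> is an extended
  backward shift, this subspace contains all \<open>h \<otimes> x\<close>, and because the ideal is admissible it is all
  of \<open>J\<close>. Hence the derivation is topologically mixing.

  Finally, a mixing operator \<open>U\<close> on a separable Banach space satisfies the Hypercyclicity Criterion
  (\<open>mixing_imp_hypercyclicity_criterion\<close>), by an argument of Bes and Peris: a Baire category argument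
  produces a vector \<open>x\<close> with dense orbit, times \<open>n_k\<close> and vectors \<open>u_k \<rightarrow> 0\<close> with
  \<open>U^(n_k) x \<rightarrow> 0\<close> and \<open>U^(n_k) u_k \<rightarrow> x\<close>. The dense subspace consists of all \<open>A x\<close>
  with \<open>A\<close> a bounded operator commuting with \<open>U\<close>, and \<open>S_(n_k) (A x) = A u_k\<close>.
\<close>

section \<open>Pade approximation of the exponential series\<close>

text \<open>
  The left-hand side is the \<open>N\<close>-th finite difference of a binomial coefficient, and a single
  difference lowers both arguments by Pascal's rule.
\<close>

lemma alternating_binomial_sum:
  assumes "N \<le> M" "j \<le> M"
  shows "(\<Sum>i\<le>N. (- 1) ^ i * real (N choose i) * real ((M - i) choose j)) = real ((M - N) choose (M - j))"
  using assms
proof (induction N arbitrary: M)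
  case 0
  then show ?case using binomial_symmetric[of j M] by simp
next
  case (Suc N)
  let ?S = "\<lambda>N M. \<Sum>i\<le>N. (- 1) ^ i * real (N choose i) * real ((M - i) choose j)"
  from Suc.prems obtain M' where M: "M = Suc M'" by (cases M) auto
  have Pascal: "?S (Suc N) M = ?S N M - ?S N M'"
  proof -
    have "?S (Suc N) M =
        (\<Sum>i\<le>Suc N. (- 1) ^ i * real (N choose i) * real ((M - i) choose j))
      + (\<Sum>i\<le>Suc N. if i = 0 then 0 else (- 1) ^ i * real (N choose (i - 1)) * real ((M - i) choose j))"
      unfolding sum.distrib[symmetric]
    proof (rule sum.cong, goal_cases)
      case (2 i)
      then show ?case by (cases i) (simp_all add: algebra_simps)
    qed simp
    also have "(\<Sum>i\<le>Suc N. if i = 0 then 0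
        else (- 1) ^ i * real (N choose (i - 1)) * real ((M - i) choose j)) = - ?S N M'"
      by (subst sum.atMost_Suc_shift) (simp add: M sum_negf)
    finally show ?thesis by (simp add: binomial_eq_0)
  qed
  show ?case
  proof (cases "j = M")
    case True
    have "?S (Suc N) M = (\<Sum>i\<le>Suc N. if i = 0 then 1 else 0)"
      using True M by (intro sum.cong) auto
    then show ?thesis using True by simp
  next
    case False
    with Suc.prems M have "j \<le> M'" "N \<le> M'" by auto
    moreover have "M - N = Suc (M' - N)" "M - j = Suc (M' - j)"
      using M \<open>j \<le> M'\<close> \<open>N \<le> M'\<close> by auto
    ultimately show ?thesis
      using Pascal Suc.IH[of M] Suc.IH[of M'] Suc.prems \<open>j \<le> M'\<close> M by (simp only:) simp
  qed
qed

text \<open>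
  For positive \<open>j\<close>, the denominator of the Pade approximant of \<open>exp\<close> with numerator degree \<open>j\<close> and denominator
  degree \<open>j - 1\<close>, normalised so that the numerator is monic.
\<close>

definition pade_coeff :: "nat \<Rightarrow> nat \<Rightarrow> real" where
  "pade_coeff j i = (if i < j then (- 1) ^ i * fact j * real ((2 * j - 1 - i) choose j) / fact i else 0)"

text \<open>
  The coefficients of \<open>exp\<close> times the denominator, in the range where they have to agree with those
  of the monic numerator of degree \<open>j\<close>. Up to the factor \<open>fact j / fact l\<close> the sum is an
  alternating binomial sum: the terms with \<open>j \<le> i\<close> vanish there too.
\<close>

lemma pade_coeff_sum:
  assumes "j \<le> l" "l < 2 * j"
  shows "(\<Sum>i\<le>l. pade_coeff j i / fact (l - i)) = (if l = j then 1 else 0)"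
proof -
  have "(\<Sum>i\<le>l. pade_coeff j i / fact (l - i)) =
      (\<Sum>i\<le>l. fact j / fact l * ((- 1) ^ i * real (l choose i) * real ((2 * j - 1 - i) choose j)))"
  proof (rule sum.cong, goal_cases)
    case (2 i)
    show ?case
    proof (cases "i < j")
      case True
      have cancel: "a * b * c / d / e = b / f * (a * (f / (d * e)) * c)" if "f \<noteq> 0" for a b c d e f :: real
        using that by simp
      from True 2 show ?thesis
        using cancel[OF fact_nonzero] by (simp only: pade_coeff_def binomial_fact atMost_iff if_True)
    next
      case False
      with assms have "(2 * j - 1 - i) choose j = 0" by (intro binomial_eq_0) linarith
      then show ?thesis using False by (simp add: pade_coeff_def)
    qed
  qed simp
  also have "\<dots> = fact j / fact l * real ((2 * j - 1 - l) choose (j - 1))"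
  proof -
    have "2 * j - 1 - j = j - 1" "l \<le> 2 * j - 1" "j \<le> 2 * j - 1" using assms by auto
    then show ?thesis
      using alternating_binomial_sum[of l "2 * j - 1" j] by (simp only: sum_distrib_left[symmetric])
  qed
  also have "\<dots> = (if l = j then 1 else 0)"
  proof (cases "l = j")
    case False
    with assms have "(2 * j - 1 - l) choose (j - 1) = 0" by (intro binomial_eq_0) linarith
    with False show ?thesis by simp
  qed simp
  finally show ?thesis .
qed

text \<open>
  With \<open>b\<close> the Pade denominator and \<open>p\<close> the numerator, this is \<open>b (t X) / t^j\<close>, so that
  \<open>exp (t X)\<close> maps it to \<open>p (t X) / t^j\<close> modulo \<open>X^(2j)\<close>. As \<open>b\<close> has degree less than \<open>j\<close>
  and \<open>p\<close> is monic of degree \<open>j\<close>, the two tend to \<open>0\<close> and to \<open>X^j\<close> when \<open>t\<close> becomes large,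
  whatever its sign.
\<close>

definition pade_poly :: "nat \<Rightarrow> real \<Rightarrow> real fps" where
  "pade_poly j t = Abs_fps (\<lambda>i. pade_coeff j i * t ^ i / t ^ j)"

lemma tendsto_power_quotient_0:
  fixes t :: "nat \<Rightarrow> real"
  assumes t: "filterlim t at_infinity sequentially" and "i < j"
  shows "(\<lambda>n. t n ^ i / t n ^ j) \<longlonglongrightarrow> 0"
proof -
  have lim: "(\<lambda>n. inverse (t n) ^ (j - i)) \<longlonglongrightarrow> 0 ^ (j - i)"
    by (intro tendsto_power filterlim_compose[OF tendsto_inverse_0 t])
  have *: "inverse x ^ (j - i) = x ^ i / x ^ j" if "x \<noteq> 0" for x :: real
    using that \<open>i < j\<close> by (simp add: power_diff divide_simps)
  have "\<forall>\<^sub>F n in sequentially. t n \<noteq> 0"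
    using t by (metis filterlim_at_infinity_imp_eventually_ne)
  then have "\<forall>\<^sub>F n in sequentially. inverse (t n) ^ (j - i) = t n ^ i / t n ^ j"
    by eventually_elim (rule *)
  with lim have "(\<lambda>n. t n ^ i / t n ^ j) \<longlonglongrightarrow> 0 ^ (j - i)"
    by (rule Lim_transform_eventually)
  moreover have "(0::real) ^ (j - i) = 0"
    using \<open>i < j\<close> by simp
  ultimately show ?thesis by (simp only:)
qed

lemma pade_poly_tendsto_0:
  assumes t: "filterlim t at_infinity sequentially"
  shows "(\<lambda>n. fps_nth (pade_poly j (t n)) l) \<longlonglongrightarrow> 0"
proof (cases "l < j")
  case True
  then show ?thesis
    using tendsto_mult_right_zero[OF tendsto_power_quotient_0[OF t True], of "pade_coeff j l"]
    by (simp add: pade_poly_def)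
qed (simp add: pade_poly_def pade_coeff_def)

lemma exp_pade_poly_tendsto:
  assumes t: "filterlim t at_infinity sequentially" and l: "l < 2 * j"
  shows "(\<lambda>n. fps_nth (fps_exp (t n) * pade_poly j (t n)) l) \<longlonglongrightarrow> fps_nth (fps_X ^ j) l"
proof -
  have nz: "\<forall>\<^sub>F n in sequentially. t n \<noteq> 0"
    using t by (metis filterlim_at_infinity_imp_eventually_ne)
  have nth: "fps_nth (fps_exp s * pade_poly j s) l =
      (\<Sum>i\<le>l. pade_coeff j i / fact (l - i)) * (s ^ l / s ^ j)" for s
  proof -
    have "fps_nth (fps_exp s * pade_poly j s) l = fps_nth (pade_poly j s * fps_exp s) l"
      by (simp add: mult.commute)
    also have "\<dots> = (\<Sum>i\<le>l. pade_coeff j i / fact (l - i) * (s ^ i * s ^ (l - i) / s ^ j))"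
      unfolding fps_mult_nth atLeast0AtMost
      by (intro sum.cong) (simp_all add: pade_poly_def mult_ac)
    also have "\<dots> = (\<Sum>i\<le>l. pade_coeff j i / fact (l - i) * (s ^ l / s ^ j))"
      by (intro sum.cong) (simp_all flip: power_add)
    finally show ?thesis unfolding sum_distrib_right .
  qed
  show ?thesis
  proof (cases "l < j")
    case True
    then show ?thesis
      using tendsto_mult_right_zero[OF tendsto_power_quotient_0[OF t True]]
      by (simp add: nth fps_X_power_nth)
  next
    case False
    have "\<forall>\<^sub>F n in sequentially. fps_nth (fps_exp (t n) * pade_poly j (t n)) l = fps_nth (fps_X ^ j) l"
      using nz by eventually_elim (use False l in \<open>simp add: nth pade_coeff_sum fps_X_power_nth\<close>)
    then show ?thesis by (rule tendsto_eventually)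
  qed
qed

lemma tendsto_fps_nth_mult:
  fixes F :: "nat \<Rightarrow> real fps"
  assumes "\<And>i. i \<le> l \<Longrightarrow> (\<lambda>n. fps_nth (F n) i) \<longlonglongrightarrow> fps_nth G i"
  shows "(\<lambda>n. fps_nth (F n * H) l) \<longlonglongrightarrow> fps_nth (G * H) l"
  unfolding fps_mult_nth by (intro tendsto_intros assms) auto

lemma tendsto_fps_nth_compose:
  fixes F :: "nat \<Rightarrow> real fps"
  assumes "\<And>i. i \<le> l \<Longrightarrow> (\<lambda>n. fps_nth (F n) i) \<longlonglongrightarrow> fps_nth G i"
  shows "(\<lambda>n. fps_nth (F n oo H) l) \<longlonglongrightarrow> fps_nth (G oo H) l"
  unfolding fps_compose_nth by (intro tendsto_intros assms) auto

text \<open>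
  Substituting \<open>L\<close> for \<open>X\<close> turns \<open>exp (n X)\<close> into \<open>E^n\<close>. The series \<open>B n\<close> come from the Pade
  polynomials with parameter \<open>n\<close>, and \<open>C n\<close> from \<open>exp (- n X)\<close> times those with parameter
  \<open>- n\<close>.
\<close>

lemma exp_power_transfer:
  fixes E L :: "real fps"
  assumes E: "E = fps_exp 1 oo L" and L0: "fps_nth L 0 = 0" and L1: "fps_nth L 1 \<noteq> 0"
  obtains B C :: "nat \<Rightarrow> real fps" where
    "\<And>l. l < 2 * j \<Longrightarrow> (\<lambda>n. fps_nth (B n) l) \<longlonglongrightarrow> 0"
    "\<And>l. l < 2 * j \<Longrightarrow> (\<lambda>n. fps_nth (E ^ n * B n) l) \<longlonglongrightarrow> fps_nth (fps_X ^ j) l"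
    "\<And>l. l < 2 * j \<Longrightarrow> (\<lambda>n. fps_nth (C n) l) \<longlonglongrightarrow> fps_nth (fps_X ^ j) l"
    "\<And>l. l < 2 * j \<Longrightarrow> (\<lambda>n. fps_nth (E ^ n * C n) l) \<longlonglongrightarrow> 0"
proof -
  \<comment> \<open>The substitution turns \<open>X^j\<close> into \<open>L^j\<close>; the unit \<open>u = (X / L)^j\<close> corrects this.\<close>
  define L' where "L' = fps_shift 1 L"
  define u where "u = inverse L' ^ j"
  have "L = fps_X * L'"
    using L0 by (simp add: L'_def fps_eq_iff)
  moreover have "L' * inverse L' = 1"
    using L1 by (intro inverse_mult_eq_1') (simp add: L'_def)
  ultimately have u: "(fps_X ^ j oo L) * u = fps_X ^ j"
    unfolding fps_X_power_compose[OF L0] u_def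
    by (metis mult.assoc mult.right_neutral power_mult_distrib power_one)
  have En: "E ^ n = fps_exp (real n) oo L" for n
    by (simp add: E fps_compose_power[OF L0] fps_exp_power_mult)
  note dist = fps_compose_mult_distrib[OF L0]
  have conv: "(\<lambda>n. fps_nth ((F n oo L) * u) l) \<longlonglongrightarrow> fps_nth ((G oo L) * u) l"
    if "\<And>i. i \<le> l \<Longrightarrow> (\<lambda>n. fps_nth (F n) i) \<longlonglongrightarrow> fps_nth G i" for F G l
    by (intro tendsto_fps_nth_mult tendsto_fps_nth_compose that) auto
  have pos: "filterlim real at_infinity sequentially"
    by (rule tendsto_of_nat)
  have neg: "filterlim (\<lambda>n. - real n) at_infinity sequentially"
    using pos by (simp add: filterlim_at_infinity_conv_norm_at_top)
  define B where "B t = (pade_poly j t oo L) * u" for t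
  define D where "D t = ((fps_exp t * pade_poly j t) oo L) * u" for t
  have B: "(\<lambda>n. fps_nth (B (t n)) l) \<longlonglongrightarrow> 0" if "filterlim t at_infinity sequentially" for t l
    using conv[of l "\<lambda>n. pade_poly j (t n)" 0] pade_poly_tendsto_0[OF that] by (simp add: B_def)
  have D: "(\<lambda>n. fps_nth (D (t n)) l) \<longlonglongrightarrow> fps_nth (fps_X ^ j) l"
    if "filterlim t at_infinity sequentially" "l < 2 * j" for t l
    using conv[of l "\<lambda>n. fps_exp (t n) * pade_poly j (t n)" "fps_X ^ j"]
      exp_pade_poly_tendsto[OF that(1)] that(2) unfolding D_def u by simp
  have EB: "E ^ n * B (real n) = D (real n)" for n
    unfolding B_def D_def En dist mult.assoc ..
  have "fps_exp t * fps_exp (- t) = 1" for t :: real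
    using fps_exp_add_mult[of t "- t"] by simp
  then have "fps_exp t * (fps_exp (- t) * F) = F" for t :: real and F
    by (simp flip: mult.assoc)
  then have ED: "E ^ n * D (- real n) = B (- real n)" for n
    unfolding B_def D_def En by (metis dist mult.assoc)
  show ?thesis
    by (rule that[of "\<lambda>n. B (real n)" "\<lambda>n. D (- real n)"])
      (simp_all only: EB ED B[OF pos] B[OF neg] D[OF pos] D[OF neg])
qed

lemma one_plus_X_eq_exp_ln: "1 + fps_X = fps_exp 1 oo (fps_ln 1 :: real fps)"
proof -
  have "(fps_exp 1 - 1) oo fps_ln 1 = (fps_X :: real fps)"
    unfolding fps_ln_fps_exp_inv[OF one_neq_zero] by (rule fps_inv_right) auto
  then show ?thesis by (simp add: fps_compose_sub_distrib algebra_simps)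
qed

section \<open>Bounded operators on a normed space with carrier\<close>

context normed_space_on
begin

interpretation M: Metric_space Y "norm_dist Y nrm"
  by (rule Metric_space_norm_dist)

lemma nrm_0 [simp]: "nrm 0 = 0"
  using nrm_eq_0_iff[OF subspace_0[OF subspace_carrier]] by simp

lemma nrm_minus_commute: "x \<in> Y \<Longrightarrow> y \<in> Y \<Longrightarrow> nrm (x - y) = nrm (y - x)"
  using nrm_scale[of "x - y" "- 1"] by (simp add: subspace_diff[OF subspace_carrier])

lemma carrier_closed [simp, intro]:
  "0 \<in> Y" "x \<in> Y \<Longrightarrow> y \<in> Y \<Longrightarrow> x + y \<in> Y" "x \<in> Y \<Longrightarrow> y \<in> Y \<Longrightarrow> x - y \<in> Y"
  "x \<in> Y \<Longrightarrow> smul c x \<in> Y"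
  using subspace_carrier by (auto intro: subspace_0 subspace_add subspace_diff subspace_scale)

lemma nrm_diff_triangle:
  "x \<in> Y \<Longrightarrow> y \<in> Y \<Longrightarrow> z \<in> Y \<Longrightarrow> nrm (x - z) \<le> nrm (x - y) + nrm (y - z)"
  using nrm_triangle[of "x - y" "y - z"] by simp

lemma limitin_norm_topology_iff:
  assumes "range s \<subseteq> Y" "y \<in> Y"
  shows "limitin (norm_topology Y nrm) s y sequentially \<longleftrightarrow> (\<lambda>n. nrm (s n - y)) \<longlonglongrightarrow> 0"
proof -
  have "s n \<in> Y" for n using assms by auto
  then show ?thesis
    using assms by (simp add: norm_topology_def M.limitin_metric norm_dist_def tendsto_iff dist_norm nrm_nonneg)
qed

lemma closure_of_eq_carrier_iff:
  assumes "S \<subseteq> Y"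
  shows "norm_topology Y nrm closure_of S = Y \<longleftrightarrow> (\<forall>y\<in>Y. \<forall>e>0. \<exists>s\<in>S. nrm (s - y) < e)"
proof -
  have "norm_topology Y nrm closure_of S = {y \<in> Y. \<forall>e>0. \<exists>s\<in>S. nrm (s - y) < e}"
    unfolding norm_topology_def M.metric_closure_of
    using assms by (intro Collect_cong conj_cong refl all_cong bex_cong)
      (auto simp: norm_dist_def nrm_minus_commute subset_iff)
  then show ?thesis by blast
qed

lemma bounded_operatorE:
  assumes "bounded_operator_on smul Y nrm A"
  obtains K where "K > 0" "\<And>x. x \<in> Y \<Longrightarrow> nrm (A x) \<le> K * nrm x"
proof -
  obtain K where K: "\<And>x. x \<in> Y \<Longrightarrow> nrm (A x) \<le> K * nrm x"
    using assms by (auto simp: bounded_operator_on_def)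
  have "nrm (A x) \<le> (\<bar>K\<bar> + 1) * nrm x" if "x \<in> Y" for x
    using K[OF that] mult_right_mono[of K "\<bar>K\<bar> + 1" "nrm x"] nrm_nonneg[OF that] by linarith
  then show ?thesis by (intro that[of "\<bar>K\<bar> + 1"]) auto
qed

lemma bounded_operatorI:
  "linear_map_on smul Y Y A \<Longrightarrow> (\<And>x. x \<in> Y \<Longrightarrow> nrm (A x) \<le> K * nrm x) \<Longrightarrow>
    bounded_operator_on smul Y nrm A"
  by (auto simp: bounded_operator_on_def)

lemma bounded_operator_closed: "bounded_operator_on smul Y nrm A \<Longrightarrow> x \<in> Y \<Longrightarrow> A x \<in> Y"
  and bounded_operator_add:
    "bounded_operator_on smul Y nrm A \<Longrightarrow> x \<in> Y \<Longrightarrow> y \<in> Y \<Longrightarrow> A (x + y) = A x + A y"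
  and bounded_operator_scale:
    "bounded_operator_on smul Y nrm A \<Longrightarrow> x \<in> Y \<Longrightarrow> A (smul c x) = smul c (A x)"
  by (auto simp: bounded_operator_on_def linear_map_on_def)

lemma bounded_operator_diff:
  assumes "bounded_operator_on smul Y nrm A" "x \<in> Y" "y \<in> Y"
  shows "A (x - y) = A x - A y"
  using bounded_operator_add[OF assms(1), of "x - y" y] assms by (simp add: algebra_simps)

lemma bounded_operator_id: "bounded_operator_on smul Y nrm (\<lambda>x. x)"
  by (auto simp: bounded_operator_on_def linear_map_on_def intro!: exI[of _ 1])

lemma bounded_operator_comp:
  assumes A: "bounded_operator_on smul Y nrm A" and B: "bounded_operator_on smul Y nrm B"
  shows "bounded_operator_on smul Y nrm (\<lambda>x. A (B x))"
proof -
  obtain K L where K: "K > 0" "\<And>x. x \<in> Y \<Longrightarrow> nrm (A x) \<le> K * nrm x"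
    and L: "\<And>x. x \<in> Y \<Longrightarrow> nrm (B x) \<le> L * nrm x"
    by (metis bounded_operatorE A B)
  have "nrm (A (B x)) \<le> (K * L) * nrm x" if "x \<in> Y" for x
    using K(2)[OF bounded_operator_closed[OF B that]] mult_left_mono[OF L[OF that], of K] K(1)
    by (simp only: mult.assoc) linarith
  then show ?thesis
    by (intro bounded_operatorI) (auto simp: linear_map_on_def
      bounded_operator_closed[OF A] bounded_operator_closed[OF B] bounded_operator_add[OF A]
      bounded_operator_add[OF B] bounded_operator_scale[OF A] bounded_operator_scale[OF B])
qed

lemma bounded_operator_funpow:
  assumes "bounded_operator_on smul Y nrm A"
  shows "bounded_operator_on smul Y nrm (A ^^ n)"
proof (induction n)
  case 0
  then show ?case using bounded_operator_id by (simp add: id_def)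
next
  case (Suc n)
  then show ?case using bounded_operator_comp[OF assms] by (simp add: o_def)
qed

lemma bounded_operator_plus:
  assumes A: "bounded_operator_on smul Y nrm A" and B: "bounded_operator_on smul Y nrm B"
  shows "bounded_operator_on smul Y nrm (\<lambda>x. A x + B x)"
proof -
  obtain K L where K: "\<And>x. x \<in> Y \<Longrightarrow> nrm (A x) \<le> K * nrm x"
    and L: "\<And>x. x \<in> Y \<Longrightarrow> nrm (B x) \<le> L * nrm x"
    by (metis bounded_operatorE A B)
  have "nrm (A x + B x) \<le> (K + L) * nrm x" if "x \<in> Y" for x
    using K[OF that] L[OF that] nrm_triangle[of "A x" "B x"] that
      bounded_operator_closed[OF A] bounded_operator_closed[OF B]
    by (fastforce simp: distrib_right)
  moreover have "linear_map_on smul Y Y (\<lambda>x. A x + B x)"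
    using A B unfolding bounded_operator_on_def linear_map_on_def
    by (auto simp: scale_right_distrib algebra_simps)
  ultimately show ?thesis by (rule bounded_operatorI[rotated])
qed

lemma bounded_operator_smul:
  assumes A: "bounded_operator_on smul Y nrm A"
  shows "bounded_operator_on smul Y nrm (\<lambda>x. smul c (A x))"
proof -
  obtain K where K: "\<And>x. x \<in> Y \<Longrightarrow> nrm (A x) \<le> K * nrm x"
    by (metis bounded_operatorE A)
  have "nrm (smul c (A x)) \<le> (norm c * K) * nrm x" if "x \<in> Y" for x
    using mult_left_mono[OF K[OF that], of "norm c"] that
    by (simp add: nrm_scale bounded_operator_closed[OF A] mult.assoc)
  moreover have "linear_map_on smul Y Y (\<lambda>x. smul c (A x))"
    using A unfolding bounded_operator_on_def linear_map_on_def
    by (auto simp: scale_right_distrib mult.commute)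
  ultimately show ?thesis by (rule bounded_operatorI[rotated])
qed

lemma openin_preimage_ball:
  assumes A: "bounded_operator_on smul Y nrm A" and d: "d \<in> Y"
  shows "openin (norm_topology Y nrm) {x \<in> Y. nrm (A x - d) < e}"
  unfolding norm_topology_def M.openin_mtopology
proof safe
  fix x assume x: "x \<in> Y" "nrm (A x - d) < e"
  obtain K where K: "K > 0" "\<And>x. x \<in> Y \<Longrightarrow> nrm (A x) \<le> K * nrm x"
    by (metis bounded_operatorE A)
  define r where "r = (e - nrm (A x - d)) / K"
  have "nrm (A y - d) < e" if y: "y \<in> M.mball x r" for y
  proof -
    have yY: "y \<in> Y" and "nrm (y - x) < r"
      using y x by (auto simp: norm_dist_def nrm_minus_commute)
    then have "nrm (A y - A x) < e - nrm (A x - d)"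
      using K(2)[of "y - x"] x \<open>K > 0\<close> by (simp add: bounded_operator_diff[OF A] r_def field_simps)
    then show ?thesis
      using nrm_diff_triangle[of "A y" "A x" d] yY x d bounded_operator_closed[OF A] by fastforce
  qed
  moreover have "r > 0" using x K by (simp add: r_def)
  ultimately show "\<exists>r>0. M.mball x r \<subseteq> {x \<in> Y. nrm (A x - d) < e}"
    by (intro exI[of _ r]) auto
qed

text \<open>
  At all large times, some orbit that started near \<open>0\<close> is near \<open>y\<close>, and some orbit that started
  near \<open>y\<close> is near \<open>0\<close>. With tolerances instead of convergent sequences it is easy to
  see that such vectors \<open>y\<close> form a closed subspace.
\<close>

definition mixing_targets :: "('v \<Rightarrow> 'v) \<Rightarrow> 'v set" where
  "mixing_targets U = {y \<in> Y. \<forall>e>0. \<forall>\<^sub>F n in sequentially.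
     (\<exists>b\<in>Y. nrm b < e \<and> nrm ((U ^^ n) b - y) < e) \<and>
     (\<exists>c\<in>Y. nrm (c - y) < e \<and> nrm ((U ^^ n) c) < e)}"

lemma mixing_targetsD:
  assumes "y \<in> mixing_targets U" "e > 0"
  shows "\<forall>\<^sub>F n in sequentially. (\<exists>b\<in>Y. nrm b < e \<and> nrm ((U ^^ n) b - y) < e) \<and>
     (\<exists>c\<in>Y. nrm (c - y) < e \<and> nrm ((U ^^ n) c) < e)"
  using assms unfolding mixing_targets_def by blast

lemma mixing_targets_add:
  assumes U: "bounded_operator_on smul Y nrm U"
    and x: "x \<in> mixing_targets U" and y: "y \<in> mixing_targets U"
  shows "x + y \<in> mixing_targets U"
proof -
  note [simp] = bounded_operator_closed[OF bounded_operator_funpow[OF U]]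
    bounded_operator_add[OF bounded_operator_funpow[OF U]]
  have xy: "x \<in> Y" "y \<in> Y" using x y by (auto simp: mixing_targets_def)
  have "\<forall>\<^sub>F n in sequentially. (\<exists>b\<in>Y. nrm b < e \<and> nrm ((U ^^ n) b - (x + y)) < e) \<and>
     (\<exists>c\<in>Y. nrm (c - (x + y)) < e \<and> nrm ((U ^^ n) c) < e)" if "e > 0" for e
  proof -
    have "e / 2 > 0" using that by simp
    from mixing_targetsD[OF x this] mixing_targetsD[OF y this] show ?thesis
    proof eventually_elim
      case (elim n)
      then obtain b b' c c' where
        b: "b \<in> Y" "nrm b < e/2" "nrm ((U ^^ n) b - x) < e/2" and
        b': "b' \<in> Y" "nrm b' < e/2" "nrm ((U ^^ n) b' - y) < e/2" and
        c: "c \<in> Y" "nrm (c - x) < e/2" "nrm ((U ^^ n) c) < e/2" and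
        c': "c' \<in> Y" "nrm (c' - y) < e/2" "nrm ((U ^^ n) c') < e/2"
        by blast
      have "nrm (b + b') < e" "nrm (c + c' - (x + y)) < e"
        "nrm ((U ^^ n) (b + b') - (x + y)) < e" "nrm ((U ^^ n) (c + c')) < e"
        using nrm_triangle[of b b'] nrm_triangle[of "(U ^^ n) b - x" "(U ^^ n) b' - y"]
          nrm_triangle[of "c - x" "c' - y"] nrm_triangle[of "(U ^^ n) c" "(U ^^ n) c'"] b b' c c' xy
        by (simp_all add: add_diff_add)
      then show ?case using b(1) b'(1) c(1) c'(1) by blast
    qed
  qed
  then show ?thesis using xy by (simp add: mixing_targets_def)
qed

lemma mixing_targets_scale:
  assumes U: "bounded_operator_on smul Y nrm U" and x: "x \<in> mixing_targets U"
  shows "smul a x \<in> mixing_targets U"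
proof -
  note [simp] = bounded_operator_closed[OF bounded_operator_funpow[OF U]]
    bounded_operator_scale[OF bounded_operator_funpow[OF U]]
  have xY: "x \<in> Y" using x by (auto simp: mixing_targets_def)
  have "\<forall>\<^sub>F n in sequentially. (\<exists>b\<in>Y. nrm b < e \<and> nrm ((U ^^ n) b - smul a x) < e) \<and>
     (\<exists>c\<in>Y. nrm (c - smul a x) < e \<and> nrm ((U ^^ n) c) < e)" if "e > 0" for e
  proof -
    define d where "d = e / (norm a + 1)"
    have "norm a + 1 > 0" by (simp add: add_nonneg_pos)
    have "d > 0" using that \<open>norm a + 1 > 0\<close> by (simp add: d_def)
    have small: "nrm (smul a v) < e" if "v \<in> Y" "nrm v < d" for v
    proof -
      have "nrm (smul a v) \<le> (norm a + 1) * nrm v"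
        using that by (simp add: nrm_scale nrm_nonneg mult_right_mono)
      also have "\<dots> < (norm a + 1) * d"
        using that \<open>norm a + 1 > 0\<close> by (intro mult_strict_left_mono)
      finally show ?thesis using \<open>norm a + 1 > 0\<close> by (simp add: d_def)
    qed
    from mixing_targetsD[OF x \<open>d > 0\<close>] show ?thesis
    proof eventually_elim
      case (elim n)
      then obtain b c where
        b: "b \<in> Y" "nrm b < d" "nrm ((U ^^ n) b - x) < d" and
        c: "c \<in> Y" "nrm (c - x) < d" "nrm ((U ^^ n) c) < d" by blast
      have "nrm (smul a b) < e" "nrm (smul a c - smul a x) < e"
        "nrm ((U ^^ n) (smul a b) - smul a x) < e" "nrm ((U ^^ n) (smul a c)) < e"
        using small[of b] small[of "c - x"] small[of "(U ^^ n) b - x"] small[of "(U ^^ n) c"] b c xY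
        by (simp_all add: scale_right_diff_distrib)
      then show ?case using b(1) c(1) by blast
    qed
  qed
  then show ?thesis using xY by (simp add: mixing_targets_def)
qed

lemma mixing_targets_0:
  assumes "bounded_operator_on smul Y nrm U"
  shows "0 \<in> mixing_targets U"
proof -
  have "(U ^^ n) 0 = 0" for n
    using bounded_operator_scale[OF bounded_operator_funpow[OF assms], of 0 n 0] by simp
  then have "\<forall>\<^sub>F n in sequentially. (\<exists>b\<in>Y. nrm b < e \<and> nrm ((U ^^ n) b - 0) < e) \<and>
     (\<exists>c\<in>Y. nrm (c - 0) < e \<and> nrm ((U ^^ n) c) < e)" if "e > 0" for e
    using that by (intro always_eventually allI conjI bexI[of _ 0]) simp_all
  then show ?thesis by (simp add: mixing_targets_def)
qed

lemma subspace_mixing_targets: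
  "bounded_operator_on smul Y nrm U \<Longrightarrow> subspace (mixing_targets U)"
  by (intro subspaceI mixing_targets_0 mixing_targets_add mixing_targets_scale)

lemma mixing_targets_closed:
  assumes U: "bounded_operator_on smul Y nrm U" and y: "y \<in> Y"
    and approx: "\<And>e. e > 0 \<Longrightarrow> \<exists>z\<in>mixing_targets U. nrm (z - y) < e"
  shows "y \<in> mixing_targets U"
proof -
  have "\<forall>\<^sub>F n in sequentially. (\<exists>b\<in>Y. nrm b < e \<and> nrm ((U ^^ n) b - y) < e) \<and>
     (\<exists>c\<in>Y. nrm (c - y) < e \<and> nrm ((U ^^ n) c) < e)" if e: "e > 0" for e
  proof -
    obtain z where z: "z \<in> mixing_targets U" "nrm (z - y) < e/2"
      using approx[OF half_gt_zero[OF e]] by blast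
    then have "z \<in> Y" by (auto simp: mixing_targets_def)
    from mixing_targetsD[OF z(1) half_gt_zero[OF e]] show ?thesis
    proof eventually_elim
      case (elim n)
      have "nrm (v - y) < e" if "v \<in> Y" "nrm (v - z) < e/2" for v
        using nrm_diff_triangle[of v z y] that z \<open>z \<in> Y\<close> y by fastforce
      moreover have "v < e" if "v < e/2" for v using that \<open>e > 0\<close> by simp
      ultimately show ?case
        using elim bounded_operator_closed[OF bounded_operator_funpow[OF U]] by meson
    qed
  qed
  then show ?thesis using y by (simp add: mixing_targets_def)
qed

text \<open>
  Topological mixing: to go from near \<open>x\<close> to near \<open>y\<close>, add a vector near \<open>x\<close> with image near
  \<open>0\<close> and a vector near \<open>0\<close> with image near \<open>y\<close>.
\<close>

lemma mixing:
  assumes U: "bounded_operator_on smul Y nrm U" and all: "mixing_targets U = Y"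
    and x: "x \<in> Y" and y: "y \<in> Y" and "e > 0"
  shows "\<forall>\<^sub>F n in sequentially. \<exists>w\<in>Y. nrm (w - x) < e \<and> nrm ((U ^^ n) w - y) < e"
proof -
  note [simp] = bounded_operator_closed[OF bounded_operator_funpow[OF U]]
    bounded_operator_add[OF bounded_operator_funpow[OF U]]
  have "e/2 > 0" using \<open>e > 0\<close> by simp
  then have "\<forall>\<^sub>F n in sequentially. \<exists>c\<in>Y. nrm (c - x) < e/2 \<and> nrm ((U ^^ n) c) < e/2"
    "\<forall>\<^sub>F n in sequentially. \<exists>b\<in>Y. nrm b < e/2 \<and> nrm ((U ^^ n) b - y) < e/2"
    using mixing_targetsD[OF _ \<open>e/2 > 0\<close>, of x U] mixing_targetsD[OF _ \<open>e/2 > 0\<close>, of y U] x y all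
    by (simp_all only: eventually_conj_iff)
  then show ?thesis
  proof eventually_elim
    case (elim n)
    then obtain b c where
      b: "b \<in> Y" "nrm b < e/2" "nrm ((U ^^ n) b - y) < e/2" and
      c: "c \<in> Y" "nrm (c - x) < e/2" "nrm ((U ^^ n) c) < e/2" by blast
    have split: "c + b - x = (c - x) + b" "(U ^^ n) (c + b) - y = (U ^^ n) c + ((U ^^ n) b - y)"
      using b c by (simp_all add: algebra_simps)
    have "nrm (c - x + b) \<le> nrm (c - x) + nrm b"
      "nrm ((U ^^ n) c + ((U ^^ n) b - y)) \<le> nrm ((U ^^ n) c) + nrm ((U ^^ n) b - y)"
      using b c x y by (intro nrm_triangle; simp)+
    with b c have "nrm (c + b - x) < e" "nrm ((U ^^ n) (c + b) - y) < e"
      unfolding split by linarith+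
    then show ?case using b(1) c(1) by blast
  qed
qed

end

section \<open>Mixing operators satisfy the Hypercyclicity Criterion\<close>

context banach_space_on
begin

interpretation M: Metric_space Y "norm_dist Y nrm"
  by (rule Metric_space_norm_dist)

text \<open>
  Each requirement on \<open>x\<close>, for a fixed tolerance and a fixed member of a countable dense set, defines
  an open set that is dense by mixing; hence the Baire category theorem applies. The last conclusion
  asks for one time \<open>n\<close> at which \<open>x\<close> is sent near \<open>0\<close> and a small \<open>u\<close> is sent near
  \<open>x\<close>: this is where all large times, not just infinitely many, are needed.
\<close>

lemma dense_orbit_with_returns:
  assumes U: "bounded_operator_on smul Y nrm U" and all: "mixing_targets U = Y"
    and sep: "separable_space (norm_topology Y nrm)"
  obtains x where "x \<in> Y"
    "\<And>y e. y \<in> Y \<Longrightarrow> e > 0 \<Longrightarrow> \<exists>n. nrm ((U ^^ n) x - y) < e"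
    "\<And>m. \<exists>n>m. \<exists>u\<in>Y. nrm u < 1 / Suc m \<and> nrm ((U ^^ n) x) < 1 / Suc m \<and>
        nrm ((U ^^ n) u - x) < 1 / Suc m"
proof -
  note Un = bounded_operator_funpow[OF U]
  note [simp] = bounded_operator_closed[OF Un]
  obtain D where D: "countable D" "D \<subseteq> Y" and "norm_topology Y nrm closure_of D = Y"
    using sep by (auto simp: separable_space_def)
  then have dense: "\<exists>d\<in>D. nrm (d - y) < e" if "y \<in> Y" "e > 0" for y e
    using closure_of_eq_carrier_iff that by blast
  define H where "H d m = (\<Union>n. {x \<in> Y. nrm ((U ^^ n) x - d) < 1 / Suc m})" for d m
  define G where "G m = (\<Union>n\<in>{m<..}. \<Union>u\<in>{u\<in>Y. nrm u < 1 / Suc m}.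
      {x \<in> Y. nrm ((U ^^ n) x - 0) < 1 / Suc m} \<inter> {x \<in> Y. nrm (x - (U ^^ n) u) < 1 / Suc m})" for m
  have openH: "openin (norm_topology Y nrm) (H d m)" if "d \<in> D" for d m
    unfolding H_def using that D by (intro openin_Union ballI) (auto intro: openin_preimage_ball[OF Un])
  have openG: "openin (norm_topology Y nrm) (G m)" for m
    unfolding G_def
    by (intro openin_Union) (auto intro!: openin_Int openin_Union
      openin_preimage_ball[OF Un, of 0, simplified] openin_preimage_ball[OF bounded_operator_id])
  have denseH: "norm_topology Y nrm closure_of (H d m) = Y" if "d \<in> D" for d m
  proof -
    have dY: "d \<in> Y" using D that by blast
    have "\<exists>w\<in>H d m. nrm (w - y) < e" if "y \<in> Y" "e > 0" for y e
    proof -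
      define r where "r = min e (1 / Suc m)"
      have "r > 0" using that by (simp add: r_def)
      then obtain n w where "w \<in> Y" "nrm (w - y) < r" "nrm ((U ^^ n) w - d) < r"
        using eventually_happens'[OF sequentially_bot mixing[OF U all \<open>y \<in> Y\<close> dY]] by blast
      then show ?thesis by (auto simp: H_def r_def)
    qed
    then show ?thesis
      by (subst closure_of_eq_carrier_iff) (auto simp: H_def)
  qed
  have denseG: "norm_topology Y nrm closure_of (G m) = Y" for m
  proof -
    have "\<exists>w\<in>G m. nrm (w - y) < e" if y: "y \<in> Y" "e > 0" for y e
    proof -
      \<comment> \<open>Half the tolerance, since \<open>w\<close> and the image of \<open>u\<close> are compared through \<open>y\<close>.\<close>
      define r where "r = min e (1 / Suc m) / 2"
      have r: "r > 0" "2 * r \<le> e" "2 * r \<le> 1 / Suc m" using that by (auto simp: r_def)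
      have "\<forall>\<^sub>F n in sequentially. n > m \<and> (\<exists>w\<in>Y. nrm (w - y) < r \<and> nrm ((U ^^ n) w - 0) < r) \<and>
          (\<exists>u\<in>Y. nrm (u - 0) < r \<and> nrm ((U ^^ n) u - y) < r)"
        using y r by (intro eventually_conj eventually_gt_at_top mixing[OF U all]) auto
      from eventually_happens'[OF sequentially_bot this] obtain n w u where n: "n > m" and w: "w \<in> Y" "nrm (w - y) < r" "nrm ((U ^^ n) w) < r"
        and u: "u \<in> Y" "nrm u < r" "nrm ((U ^^ n) u - y) < r"
        by (simp only: diff_zero) blast
      have "nrm (w - (U ^^ n) u) < 2 * r"
        using nrm_diff_triangle[of w y "(U ^^ n) u"] w u y nrm_minus_commute[of y "(U ^^ n) u"] by simp
      then have "w \<in> G m"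
      proof -
        have "nrm u < 1 / Suc m" "nrm ((U ^^ n) w - 0) < 1 / Suc m" "nrm (w - (U ^^ n) u) < 1 / Suc m"
          using \<open>nrm (w - (U ^^ n) u) < 2 * r\<close> w u r by simp_all
        then show ?thesis
          unfolding G_def using n w(1) u(1) by blast
      qed
      then show ?thesis using w r by force
    qed
    then show ?thesis
      by (subst closure_of_eq_carrier_iff) (auto simp: G_def)
  qed
  let ?\<G> = "range G \<union> (\<Union>d\<in>D. range (H d))"
  have "norm_topology Y nrm closure_of \<Inter>?\<G> = Y"
    unfolding norm_topology_def
  proof (rule M.metric_Baire_category[OF complete])
    show "countable ?\<G>" using D by auto
    fix V assume "V \<in> ?\<G>"
    then show "openin M.mtopology V \<and> M.mtopology closure_of V = Y"
      using openG denseG openH denseH unfolding norm_topology_def by fastforce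
  qed
  then have "\<Inter>?\<G> \<noteq> {}"
    using carrier_closed(1) by force
  then obtain x where x: "x \<in> \<Inter>?\<G>" by blast
  have "x \<in> G 0" using x by blast
  then have xY: "x \<in> Y" by (auto simp: G_def)
  show ?thesis
  proof (rule that[OF xY])
    fix y e assume y: "y \<in> Y" and "(e::real) > 0"
    then obtain m where m: "1 / Suc m < e/2"
      by (metis half_gt_zero nat_approx_posE)
    obtain d where d: "d \<in> D" "nrm (d - y) < e/2" using dense[of y "e/2"] y \<open>e > 0\<close> by auto
    have "x \<in> H d m" using x d by blast
    then obtain n where "nrm ((U ^^ n) x - d) < 1 / Suc m" by (auto simp: H_def)
    then have "nrm ((U ^^ n) x - y) < e"
      using nrm_diff_triangle[of "(U ^^ n) x" d y] d m xY y D by fastforce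
    then show "\<exists>n. nrm ((U ^^ n) x - y) < e" ..
  next
    fix m
    have "x \<in> G m" using x by blast
    then show "\<exists>n>m. \<exists>u\<in>Y. nrm u < 1 / Suc m \<and> nrm ((U ^^ n) x) < 1 / Suc m \<and>
        nrm ((U ^^ n) u - x) < 1 / Suc m"
      by (force simp: G_def nrm_minus_commute[OF _ xY])
  qed
qed

text \<open>
  Using the commutant of \<open>U\<close>, in place of polynomials in \<open>U\<close>, makes the subspace \<open>Y0\<close> and the
  maps \<open>S\<close> easy to handle: an element of the commutant is determined by its value at \<open>x\<close>, because
  the orbit of \<open>x\<close> is dense, and so \<open>A x \<mapsto> A u_k\<close> is well defined and linear.
\<close>

lemma mixing_imp_hypercyclicity_criterion:
  assumes U: "bounded_operator_on smul Y nrm U" and all: "mixing_targets U = Y"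
    and sep: "separable_space (norm_topology Y nrm)"
  shows "hypercyclicity_criterion smul Y nrm U"
proof -
  note Un = bounded_operator_funpow[OF U]
  note [simp] = bounded_operator_closed[OF Un]
  obtain x where x: "x \<in> Y"
    and orbit: "\<And>y e. y \<in> Y \<Longrightarrow> e > 0 \<Longrightarrow> \<exists>n. nrm ((U ^^ n) x - y) < e"
    and ret: "\<And>m. \<exists>n>m. \<exists>u\<in>Y. nrm u < 1 / Suc m \<and> nrm ((U ^^ n) x) < 1 / Suc m \<and>
        nrm ((U ^^ n) u - x) < 1 / Suc m"
    by (metis dense_orbit_with_returns[OF U all sep])
  have "\<exists>f. \<forall>k. (0 < fst (f k) \<and> snd (f k) \<in> Y \<and> nrm (snd (f k)) < 1 / Suc k \<and>
        nrm ((U ^^ fst (f k)) x) < 1 / Suc k \<and> nrm ((U ^^ fst (f k)) (snd (f k)) - x) < 1 / Suc k)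
      \<and> fst (f k) < fst (f (Suc k))"
  proof (rule dependent_nat_choice, goal_cases)
    case 1
    obtain n u where "n > 0" "u \<in> Y" "nrm u < 1" "nrm ((U ^^ n) x) < 1" "nrm ((U ^^ n) u - x) < 1"
      using ret[of 0] by auto
    then show ?case by (intro exI[of _ "(n, u)"]) simp
  next
    case (2 f k)
    define m where "m = max (fst f) (Suc k)"
    obtain n u where n: "n > m" "u \<in> Y" "nrm u < 1 / Suc m" "nrm ((U ^^ n) x) < 1 / Suc m"
      "nrm ((U ^^ n) u - x) < 1 / Suc m"
      using ret[of m] by auto
    have "1 / Suc m \<le> 1 / Suc (Suc k)" by (simp add: m_def frac_le)
    then show ?case
      using n by (intro exI[of _ "(n, u)"]) (auto simp: m_def)
  qed
  then obtain f where f: "\<And>k. 0 < fst (f k)" "\<And>k. snd (f k) \<in> Y" "\<And>k. nrm (snd (f k)) < 1 / Suc k"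
    "\<And>k. nrm ((U ^^ fst (f k)) x) < 1 / Suc k" "\<And>k. nrm ((U ^^ fst (f k)) (snd (f k)) - x) < 1 / Suc k"
    "\<And>k. fst (f k) < fst (f (Suc k))" by blast
  define n where "n k = fst (f k)" for k
  define u where "u k = snd (f k)" for k
  have n: "strict_mono n" using f(6) by (simp add: n_def strict_mono_Suc_iff)
  have uY: "u k \<in> Y" for k by (simp add: u_def f)
  have lim0: "(\<lambda>k. 1 / real (Suc k)) \<longlonglongrightarrow> 0"
    using LIMSEQ_Suc[OF lim_const_over_n[of 1]] by simp
  have squeeze: "g \<longlonglongrightarrow> 0" if "\<And>k. 0 \<le> g k" "\<And>k. g k < 1 / Suc k" for g :: "nat \<Rightarrow> real"
    by (intro tendsto_sandwich[OF _ _ tendsto_const lim0] always_eventually allI that less_imp_le[OF that(2)])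
  have u0: "(\<lambda>k. nrm (u k)) \<longlonglongrightarrow> 0" and x0: "(\<lambda>k. nrm ((U ^^ n k) x)) \<longlonglongrightarrow> 0"
    and ux: "(\<lambda>k. nrm ((U ^^ n k) (u k) - x)) \<longlonglongrightarrow> 0"
    using f x by (auto intro!: squeeze nrm_nonneg simp: u_def n_def)

  define \<C> where "\<C> = {A. bounded_operator_on smul Y nrm A \<and> (\<forall>y\<in>Y. A (U y) = U (A y))}"
  have bdd: "bounded_operator_on smul Y nrm A" if "A \<in> \<C>" for A
    using that by (simp add: \<C>_def)
  note \<C>_closed [simp] = bounded_operator_closed[OF bdd]
  have comm: "A ((U ^^ m) y) = (U ^^ m) (A y)" if "A \<in> \<C>" "y \<in> Y" for A m y
    using that by (induction m) (auto simp: \<C>_def)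
  have plus: "(\<lambda>y. A y + B y) \<in> \<C>" if "A \<in> \<C>" "B \<in> \<C>" for A B
    using that unfolding \<C>_def
    by (auto simp: bounded_operator_plus bounded_operator_closed bounded_operator_add[OF U])
  have smulC: "(\<lambda>y. smul c (A y)) \<in> \<C>" if "A \<in> \<C>" for A c
    using that unfolding \<C>_def
    by (auto simp: bounded_operator_smul bounded_operator_closed bounded_operator_scale[OF U])
  have UC: "U ^^ m \<in> \<C>" for m
    using Un by (auto simp: \<C>_def funpow_swap1)
  have ext: "A y = B y" if A: "A \<in> \<C>" and B: "B \<in> \<C>" and eq: "A x = B x" and y: "y \<in> Y" for A B y
  proof -
    define D where "D = (\<lambda>y. A y + smul (- 1) (B y))"
    have D: "bounded_operator_on smul Y nrm D" and D': "D \<in> \<C>"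
      using plus[OF A smulC[OF B, of "- 1"]] by (simp_all add: D_def \<C>_def)
    obtain K where K: "K > 0" "\<And>x. x \<in> Y \<Longrightarrow> nrm (D x) \<le> K * nrm x"
      by (metis bounded_operatorE D)
    have D0: "D ((U ^^ m) x) = 0" for m
    proof -
      have "D x = 0" using eq by (simp add: D_def)
      then show ?thesis
        using comm[OF D' x] bounded_operator_scale[OF Un, of 0 m 0] by simp
    qed
    have "nrm (D y) \<le> e" if e: "e > 0" for e
    proof -
      obtain m where m: "nrm ((U ^^ m) x - y) < e / K"
        using orbit[OF y divide_pos_pos[OF e K(1)]] by blast
      have "nrm (D y) = nrm (D (y - (U ^^ m) x))"
        using D0 bounded_operator_diff[OF D] x y by simp
      also have "\<dots> \<le> K * nrm ((U ^^ m) x - y)"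
        using K x y by (simp add: nrm_minus_commute)
      also have "\<dots> \<le> e" using m K by (simp add: field_simps)
      finally show ?thesis .
    qed
    then have "nrm (D y) = 0"
      using nrm_nonneg[OF bounded_operator_closed[OF D y]] by (metis field_le_epsilon add.left_neutral order_antisym)
    then have "D y = 0" using nrm_eq_0_iff[OF bounded_operator_closed[OF D y]] by simp
    then show ?thesis by (simp add: D_def)
  qed

  define Y0 where "Y0 = (\<lambda>A. A x) ` \<C>"
  \<comment> \<open>The maps are indexed by the times \<open>n k\<close>, hence the inverse of \<open>n\<close>.\<close>
  define S where "S m y = (SOME A. A \<in> \<C> \<and> A x = y) (u (inv n m))" for m y
  have S: "S (n k) (A x) = A (u k)" if "A \<in> \<C>" for A k
  proof -
    have "(SOME B. B \<in> \<C> \<and> B x = A x) \<in> \<C> \<and> (SOME B. B \<in> \<C> \<and> B x = A x) x = A x"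
      by (rule someI[of _ A]) (use that in auto)
    then have "(SOME B. B \<in> \<C> \<and> B x = A x) (u k) = A (u k)"
      using ext[OF _ that _ uY] by blast
    then show ?thesis
      using n by (simp add: S_def strict_mono_imp_inj_on)
  qed
  have sub: "subspace Y0"
  proof (rule subspaceI)
    show "0 \<in> Y0" unfolding Y0_def
      using smulC[OF UC, of 0 0] by (intro image_eqI) auto
    show "y + z \<in> Y0" if "y \<in> Y0" "z \<in> Y0" for y z
      using that plus unfolding Y0_def by (auto intro: image_eqI[of _ _ "\<lambda>y. _ y + _ y"])
    show "smul c y \<in> Y0" if "y \<in> Y0" for c y
      using that smulC unfolding Y0_def by (auto intro: image_eqI[of _ _ "\<lambda>y. smul c (_ y)"])
  qed
  have Y0: "Y0 \<subseteq> Y" using x by (auto simp: Y0_def)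
  have "norm_topology Y nrm closure_of Y0 = Y"
    unfolding closure_of_eq_carrier_iff[OF Y0]
  proof (intro ballI allI impI)
    fix y e assume "y \<in> Y" "(e::real) > 0"
    then obtain m where "nrm ((U ^^ m) x - y) < e" using orbit by blast
    then show "\<exists>s\<in>Y0. nrm (s - y) < e" using UC unfolding Y0_def by blast
  qed
  moreover have "linear_map_on smul Y0 Y (S (n k))" for k
    unfolding linear_map_on_def
  proof (intro conjI ballI allI)
    show "S (n k) \<in> Y0 \<rightarrow> Y" using uY by (auto simp: Y0_def S)
    show "S (n k) (y + z) = S (n k) y + S (n k) z" if "y \<in> Y0" "z \<in> Y0" for y z
      using that S plus by (force simp: Y0_def)
    show "S (n k) (smul c y) = smul c (S (n k) y)" if "y \<in> Y0" for c y
      using that S smulC by (force simp: Y0_def)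
  qed
  moreover have "limitin (norm_topology Y nrm) (\<lambda>k. (U ^^ n k) y) 0 sequentially \<and>
           limitin (norm_topology Y nrm) (\<lambda>k. S (n k) y) 0 sequentially \<and>
           limitin (norm_topology Y nrm) (\<lambda>k. (U ^^ n k) (S (n k) y)) y sequentially" if "y \<in> Y0" for y
  proof -
    obtain A where A: "A \<in> \<C>" "y = A x" using \<open>y \<in> Y0\<close> by (auto simp: Y0_def)
    obtain K where K: "\<And>x. x \<in> Y \<Longrightarrow> nrm (A x) \<le> K * nrm x"
      by (metis bounded_operatorE bdd[OF A(1)])
    have lim: "(\<lambda>k. nrm (A (v k))) \<longlonglongrightarrow> 0" if "\<And>k. v k \<in> Y" "(\<lambda>k. nrm (v k)) \<longlonglongrightarrow> 0" for v
    proof (rule tendsto_sandwich[OF _ _ tendsto_const])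
      show "(\<lambda>k. K * nrm (v k)) \<longlonglongrightarrow> 0" using tendsto_mult_right_zero[OF that(2)] .
    qed (use that K nrm_nonneg A in auto)
    have 1: "(\<lambda>k. nrm ((U ^^ n k) y)) \<longlonglongrightarrow> 0"
      using lim[OF _ x0] A x by (simp add: comm)
    have 2: "(\<lambda>k. nrm (S (n k) y)) \<longlonglongrightarrow> 0"
      using lim[OF uY u0] A by (simp add: S)
    have "(U ^^ n k) (S (n k) y) - y = A ((U ^^ n k) (u k) - x)" for k
      using A x uY by (simp add: S comm bounded_operator_diff[OF bdd])
    then have 3: "(\<lambda>k. nrm ((U ^^ n k) (S (n k) y) - y)) \<longlonglongrightarrow> 0"
      using lim[OF _ ux] uY x by simp
    have "y \<in> Y" "range (\<lambda>k. (U ^^ n k) y) \<subseteq> Y" "range (\<lambda>k. S (n k) y) \<subseteq> Y"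
      "range (\<lambda>k. (U ^^ n k) (S (n k) y)) \<subseteq> Y"
      using A x uY by (auto simp: S)
    then show ?thesis using 1 2 3 by (simp add: limitin_norm_topology_iff)
  qed
  moreover have "\<forall>k. 0 < n k" by (simp add: n_def f(1))
  ultimately have "\<exists>Y0 (n :: nat \<Rightarrow> nat) S.
        subspace Y0 \<and> Y0 \<subseteq> Y \<and> norm_topology Y nrm closure_of Y0 = Y \<and>
        strict_mono n \<and> (\<forall>k. 0 < n k) \<and>
        (\<forall>k. linear_map_on smul Y0 Y (S (n k))) \<and>
        (\<forall>y\<in>Y0.
           limitin (norm_topology Y nrm) (\<lambda>k. (U ^^ n k) y) 0 sequentially \<and>
           limitin (norm_topology Y nrm) (\<lambda>k. S (n k) y) 0 sequentially \<and>
           limitin (norm_topology Y nrm) (\<lambda>k. (U ^^ n k) (S (n k) y)) y sequentially)"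
    using sub Y0 n by (intro exI[of _ Y0] exI[of _ n] exI[of _ S]) blast
  then show ?thesis
    unfolding hypercyclicity_criterion_def using U sep banach_space_on_axioms by blast
qed

end

section \<open>Power series acting on the generalised kernel of an operator\<close>

text \<open>
  The value of the series \<open>F (V)\<close> at a vector killed by \<open>V^m\<close>; on such vectors the truncation is
  immaterial and the product of series becomes composition.
\<close>

definition fps_act :: "('v \<Rightarrow> 'v) \<Rightarrow> nat \<Rightarrow> real fps \<Rightarrow> 'v \<Rightarrow> 'v::real_vector" where
  "fps_act V m F g = (\<Sum>i<m. fps_nth F i *\<^sub>R (V ^^ i) g)"

lemma linear_funpow: "linear V \<Longrightarrow> linear (V ^^ i)"
  for V :: "'v::real_vector \<Rightarrow> 'v"
  by (induction i) (auto intro: linear_compose linear_id)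

lemma funpow_eq_0_mono:
  fixes V :: "'v::real_vector \<Rightarrow> 'v"
  assumes "linear V" "(V ^^ m) g = 0" "m \<le> n"
  shows "(V ^^ n) g = 0"
proof -
  have "(V ^^ n) g = (V ^^ (n - m)) ((V ^^ m) g)"
    using assms(3) by (simp flip: funpow_add[unfolded o_def, THEN fun_cong])
  then show ?thesis using assms linear_0[OF linear_funpow] by simp
qed

lemma funpow_fps_act:
  fixes V :: "'v::real_vector \<Rightarrow> 'v"
  assumes "linear V"
  shows "(V ^^ i) (fps_act V m F g) = (\<Sum>k<m. fps_nth F k *\<^sub>R (V ^^ (i + k)) g)"
  unfolding fps_act_def
  by (simp add: linear_sum[OF linear_funpow[OF assms]] linear_scale[OF linear_funpow[OF assms]] funpow_add)

lemma funpow_fps_act_eq_0: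
  fixes V :: "'v::real_vector \<Rightarrow> 'v"
  assumes "linear V" "(V ^^ m) g = 0"
  shows "(V ^^ m) (fps_act V m F g) = 0"
  using funpow_eq_0_mono[OF assms] by (simp add: funpow_fps_act[OF assms(1)])

lemma fps_act_mult:
  fixes V :: "'v::real_vector \<Rightarrow> 'v"
  assumes V: "linear V" and g: "(V ^^ m) g = 0"
  shows "fps_act V m (F * G) g = fps_act V m F (fps_act V m G g)"
proof -
  define h where "h i k = (fps_nth F i * fps_nth G k) *\<^sub>R (V ^^ (i + k)) g" for i k
  have h0: "h i k = 0" if "\<not> i + k < m" for i k
    using funpow_eq_0_mono[OF V g, of "i + k"] that by (simp add: h_def)
  have "fps_act V m (F * G) g = (\<Sum>l<m. \<Sum>i\<le>l. h i (l - i))"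
    by (simp add: fps_act_def fps_mult_nth h_def scaleR_sum_left atLeast0AtMost)
  also have "\<dots> = (\<Sum>(i, k)\<in>{(i, k). i + k < m}. h i k)"
    by (rule sum.triangle_reindex[symmetric])
  also have "\<dots> = (\<Sum>(i, k)\<in>{..<m} \<times> {..<m}. h i k)"
    using h0 by (intro sum.mono_neutral_left) auto
  also have "\<dots> = fps_act V m F (fps_act V m G g)"
    by (subst fps_act_def) (simp add: funpow_fps_act[OF V] h_def scaleR_sum_right flip: sum.cartesian_product)
  finally show ?thesis .
qed

lemma fps_act_X_power:
  fixes V :: "'v::real_vector \<Rightarrow> 'v"
  assumes "j < m"
  shows "fps_act V m (fps_X ^ j) g = (V ^^ j) g"
proof -
  have "fps_act V m (fps_X ^ j) g = (\<Sum>i<m. if i = j then (V ^^ i) g else 0)"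
    unfolding fps_act_def by (intro sum.cong) (auto simp: fps_X_power_nth)
  then show ?thesis using assms by simp
qed

lemma tendsto_fps_act:
  fixes V :: "'v::real_normed_vector \<Rightarrow> 'v"
  assumes "\<And>i. i < m \<Longrightarrow> (\<lambda>n. fps_nth (F n) i) \<longlonglongrightarrow> fps_nth G i"
  shows "(\<lambda>n. fps_act V m (F n) g) \<longlonglongrightarrow> fps_act V m G g"
  unfolding fps_act_def using assms by (intro tendsto_sum tendsto_scaleR tendsto_const) auto

lemma linear_dual_adjoint: "linear (dual_adjoint T)"
  by (rule linearI) (auto intro!: blinfun_eqI simp: dual_adjoint_def blinfun.add_left blinfun.scaleR_left)

lemma dual_adjoint_funpow: "(dual_adjoint T ^^ j) h = h o\<^sub>L blinfun_pow T j"
proof (induction j arbitrary: h)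
  case 0
  show ?case by (auto intro!: blinfun_eqI simp: blinfun_pow_def)
next
  case (Suc j)
  have "(dual_adjoint T ^^ Suc j) h = (dual_adjoint T ^^ j) (h o\<^sub>L T)"
    by (simp add: funpow_swap1) (simp add: dual_adjoint_def)
  also have "\<dots> = h o\<^sub>L blinfun_pow T (Suc j)"
    unfolding Suc.IH by (auto intro!: blinfun_eqI simp: blinfun_pow_def)
  finally show ?case .
qed

lemma one_plus_adjoint_eq_fps_act:
  assumes h: "(dual_adjoint T ^^ m) h = 0"
  shows "h + dual_adjoint T h = fps_act (dual_adjoint T) m (1 + fps_X) h"
proof -
  let ?V = "dual_adjoint T"
  have "fps_act ?V m (1 + fps_X) h = fps_act ?V (Suc (Suc m)) (1 + fps_X) h"
    unfolding fps_act_def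
    using funpow_eq_0_mono[OF linear_dual_adjoint h]
    by (intro sum.mono_neutral_left) (auto simp del: funpow.simps)
  also have "\<dots> = h + ?V h + (\<Sum>i<m. fps_nth (1 + fps_X) (Suc (Suc i)) *\<^sub>R (?V ^^ Suc (Suc i)) h)"
    unfolding fps_act_def by (simp add: sum.lessThan_Suc_shift del: sum.lessThan_Suc)
  also have "\<dots> = h + ?V h" by (simp add: fps_X_def)
  finally show ?thesis ..
qed

text \<open>
  The series defining \<open>T'\<close> is that of \<open>exp T - I\<close>; applied to \<open>h\<close> it terminates.
\<close>

lemma exp_adjoint_eq_fps_act:
  fixes T :: "'a::banach \<Rightarrow>\<^sub>L 'a" and h :: "'a \<Rightarrow>\<^sub>L 'b::real_normed_vector"
  assumes h: "(dual_adjoint T ^^ m) h = 0"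
  shows "h + dual_adjoint (\<Sum>j. (1 / fact (Suc j)) *\<^sub>R blinfun_pow T (Suc j)) h =
    fps_act (dual_adjoint T) m (fps_exp 1) h"
proof -
  let ?V = "dual_adjoint T"
  have "(\<lambda>j. h o\<^sub>L ((1 / fact (Suc j)) *\<^sub>R blinfun_pow T (Suc j))) sums
      (h o\<^sub>L (\<Sum>j. (1 / fact (Suc j)) *\<^sub>R blinfun_pow T (Suc j)))"
    by (intro bounded_linear.sums[OF bounded_bilinear.bounded_linear_right[OF bounded_bilinear_blinfun_compose]] summable_sums summable_blinfun_pow) 
  moreover have "h o\<^sub>L ((1 / fact (Suc j)) *\<^sub>R blinfun_pow T (Suc j)) = (1 / fact (Suc j)) *\<^sub>R (?V ^^ Suc j) h" for j
    unfolding dual_adjoint_funpow by (auto intro!: blinfun_eqI simp: blinfun.scaleR_left blinfun.scaleR_right)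
  ultimately have "(\<lambda>j. (1 / fact (Suc j)) *\<^sub>R (?V ^^ Suc j) h) sums
      dual_adjoint (\<Sum>j. (1 / fact (Suc j)) *\<^sub>R blinfun_pow T (Suc j)) h"
    by (simp only: dual_adjoint_def)
  then have "(\<lambda>j. (1 / fact j) *\<^sub>R (?V ^^ j) h) sums
      (dual_adjoint (\<Sum>j. (1 / fact (Suc j)) *\<^sub>R blinfun_pow T (Suc j)) h + h)"
    by (subst (asm) sums_Suc_iff) simp
  moreover have "(\<lambda>j. (1 / fact j) *\<^sub>R (?V ^^ j) h) sums (\<Sum>j<m. (1 / fact j) *\<^sub>R (?V ^^ j) h)"
    using funpow_eq_0_mono[OF linear_dual_adjoint h] by (intro sums_finite) (auto simp: not_less)
  ultimately show ?thesis
    unfolding fps_act_def by (simp add: sums_unique2 add.commute)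
qed

section \<open>Generalised derivations on a Banach ideal\<close>

context scalar_banach_space
begin

lemma mem_dual_iff: "f \<in> dual smul \<longleftrightarrow> (\<forall>c z. f (smul c z) = c * f z)"
  unfolding bounded_linear_maps_def mem_Collect_eq Vector_Spaces.linear_iff
  using vector_space_axioms vector_space_over_itself.vector_space_axioms
  by (auto simp: blinfun.add_right)

lemma mem_operators_iff: "A \<in> operators smul \<longleftrightarrow> (\<forall>c z. A (smul c z) = smul c (A z))"
  unfolding bounded_linear_maps_def mem_Collect_eq Vector_Spaces.linear_iff
  using vector_space_axioms by (auto simp: blinfun.add_right)

lemma dual_closed:
  "0 \<in> dual smul" "f \<in> dual smul \<Longrightarrow> g \<in> dual smul \<Longrightarrow> f + g \<in> dual smul"
  "f \<in> dual smul \<Longrightarrow> r *\<^sub>R f \<in> dual smul"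
  "f \<in> dual smul \<Longrightarrow> A \<in> operators smul \<Longrightarrow> dual_adjoint A f \<in> dual smul"
  by (auto simp: mem_dual_iff mem_operators_iff dual_adjoint_def blinfun.add_left blinfun.scaleR_left algebra_simps)

lemma fps_act_in_dual:
  assumes "T \<in> operators smul" "f \<in> dual smul"
  shows "fps_act (dual_adjoint T) m F f \<in> dual smul"
proof -
  have "(dual_adjoint T ^^ i) f \<in> dual smul" for i
    by (induction i) (simp_all add: assms dual_closed)
  then show ?thesis
    unfolding fps_act_def by (induction m) (simp_all add: dual_closed)
qed

lemma id_in_operators: "id_blinfun \<in> operators smul"
  by (simp add: mem_operators_iff)

lemma power_sum_in_operators:
  assumes "T \<in> operators smul"
  shows "(\<Sum>j. (1 / fact (Suc j)) *\<^sub>R blinfun_pow T (Suc j)) \<in> operators smul"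
proof -
  have pow: "blinfun_pow T j (smul c z) = smul c (blinfun_pow T j z)" for j c z
    using assms by (induction j) (auto simp: blinfun_pow_def mem_operators_iff)
  let ?S = "\<Sum>j. (1 / fact (Suc j)) *\<^sub>R blinfun_pow T (Suc j)"
  have S: "(\<lambda>j. (1 / fact (Suc j)) *\<^sub>R blinfun_pow T (Suc j) z) sums ?S z" for z
    using bounded_linear.sums[OF blinfun.bounded_linear_left[of z] summable_sums[OF summable_blinfun_pow[of T]]]
    by (simp add: blinfun.scaleR_left)
  have "?S (smul c z) = smul c (?S z)" for c z
  proof -
    have "(\<lambda>j. smul c ((1 / fact (Suc j)) *\<^sub>R blinfun_pow T (Suc j) z)) sums smul c (?S z)"
      by (rule bounded_linear.sums[OF bounded_linear_scale_right S])
    then show ?thesis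
      using S[of "smul c z"]
      by (simp add: pow sums_unique2 linear_scale[OF bounded_linear.linear[OF bounded_linear_scale_right]])
  qed
  then show ?thesis by (simp add: mem_operators_iff)
qed

lemma rank_one_add: "rank_one smul (f + g) x = rank_one smul f x + rank_one smul g x"
  and rank_one_diff: "rank_one smul (f - g) x = rank_one smul f x - rank_one smul g x"
  and rank_one_scale: "rank_one smul (map_scale (*) c f) x = map_scale smul c (rank_one smul f x)"
  and rank_one_compose: "rank_one smul f x o\<^sub>L A = rank_one smul (dual_adjoint A f) x"
  by (auto intro!: blinfun_eqI simp: blinfun.add_left blinfun.diff_left scale_left_distrib scale_left_diff_distrib
    dual_adjoint_def scalar_banach_space.map_scale_apply[OF scalar_banach_space_field])

end

context banach_ideal
begin

sublocale J: banach_space_on "map_scale smul" J normJ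
  by (rule ideal_banach)

lemma generalised_derivation_id: "generalised_derivation id_blinfun (- A) S = S + (S o\<^sub>L A)"
  by (auto intro!: blinfun_eqI simp: generalised_derivation_def left_mult_def right_mult_def
    blinfun.add_left blinfun.diff_left blinfun.minus_left blinfun.minus_right)

lemma bounded_generalised_derivation:
  assumes A: "A \<in> operators smul"
  shows "bounded_operator_on (map_scale smul) J normJ (generalised_derivation id_blinfun (- A))"
proof (rule J.bounded_operatorI)
  have comp: "S o\<^sub>L A \<in> J" "normJ (S o\<^sub>L A) \<le> norm A * normJ S" if "S \<in> J" for S
  proof -
    have id: "id_blinfun o\<^sub>L S o\<^sub>L A = S o\<^sub>L A" by (auto intro!: blinfun_eqI)
    show "S o\<^sub>L A \<in> J" using ideal_mult[OF A id_in_operators that] by (simp add: id)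
    have "normJ (S o\<^sub>L A) \<le> norm (id_blinfun :: 'a \<Rightarrow>\<^sub>L 'a) * (norm A * normJ S)"
      using normJ_mult[OF A id_in_operators that] by (simp add: id mult.assoc)
    also have "\<dots> \<le> 1 * (norm A * normJ S)"
      using J.nrm_nonneg[OF that] by (intro mult_right_mono norm_blinfun_id_le) auto
    finally show "normJ (S o\<^sub>L A) \<le> norm A * normJ S" by simp
  qed
  show "linear_map_on (map_scale smul) J J (generalised_derivation id_blinfun (- A))"
    unfolding linear_map_on_def
    using comp(1) by (auto simp: generalised_derivation_id blinfun.add_left scale_right_distrib intro!: blinfun_eqI)
  show "normJ (generalised_derivation id_blinfun (- A) S) \<le> (1 + norm A) * normJ S" if "S \<in> J" for S
    using J.nrm_triangle[OF that comp(1)[OF that]] comp(2)[OF that]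
    by (simp add: generalised_derivation_id distrib_right)
qed

lemma generalised_derivation_power_rank_one:
  "(generalised_derivation id_blinfun (- A) ^^ n) (rank_one smul f x) =
    rank_one smul (((\<lambda>h. h + dual_adjoint A h) ^^ n) f) x"
  by (induction n) (simp_all add: generalised_derivation_id rank_one_compose rank_one_add)

text \<open>
  As \<open>h \<mapsto> h \<otimes> x\<close> is continuous from the dual space into the ideal, approximations in the dual
  space carry over to rank one operators.
\<close>

lemma rank_one_in_mixing_targets:
  assumes A: "A \<in> operators smul" and f: "f \<in> dual smul"
    and b: "\<And>n. b n \<in> dual smul" "b \<longlonglongrightarrow> 0"
      "(\<lambda>n. ((\<lambda>h. h + dual_adjoint A h) ^^ n) (b n)) \<longlonglongrightarrow> f"
    and c: "\<And>n. c n \<in> dual smul" "c \<longlonglongrightarrow> f"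
      "(\<lambda>n. ((\<lambda>h. h + dual_adjoint A h) ^^ n) (c n)) \<longlonglongrightarrow> 0"
  shows "rank_one smul f x \<in> J.mixing_targets (generalised_derivation id_blinfun (- A))"
proof -
  let ?W = "\<lambda>h. h + dual_adjoint A h :: 'a \<Rightarrow>\<^sub>L 'k" and ?r = "\<lambda>h. rank_one smul h x"
  have W: "(?W ^^ n) h \<in> dual smul" if "h \<in> dual smul" for n h
    using that by (induction n) (simp_all add: dual_closed A)
  have lim: "\<forall>\<^sub>F n in sequentially. normJ (?r (g n) - ?r h) < e"
    if g: "\<And>n. g n \<in> dual smul" "g \<longlonglongrightarrow> h" and h: "h \<in> dual smul" and "e > 0" for g h e
  proof -
    have "(\<lambda>n. norm (g n - h) * norm x) \<longlonglongrightarrow> 0"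
      using g(2) by (intro tendsto_mult_left_zero tendsto_norm_zero) (simp add: LIM_zero)
    moreover have "normJ (?r (g n) - ?r h) = norm (g n - h) * norm x" for n
    proof -
      have "g n - h \<in> dual smul"
        using dual_closed(2)[OF g(1)[of n] dual_closed(3)[OF h, of "- 1"]] by simp
      then show ?thesis by (simp flip: rank_one_diff add: normJ_rank_one)
    qed
    ultimately show ?thesis using \<open>e > 0\<close> by (simp add: order_tendsto_iff)
  qed
  have r0: "?r 0 = 0" by (auto intro!: blinfun_eqI)
  have "\<forall>\<^sub>F n in sequentially.
     (\<exists>b\<in>J. normJ b < e \<and> normJ ((generalised_derivation id_blinfun (- A) ^^ n) b - ?r f) < e) \<and>
     (\<exists>c\<in>J. normJ (c - ?r f) < e \<and> normJ ((generalised_derivation id_blinfun (- A) ^^ n) c) < e)"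
    if "e > 0" for e
    using lim[OF b(1,2) dual_closed(1) that] lim[OF W[OF b(1)] b(3) f that]
      lim[OF c(1,2) f that] lim[OF W[OF c(1)] c(3) dual_closed(1) that]
  proof eventually_elim
    case (elim n)
    then show ?case
      by (intro conjI bexI[of _ "?r (b n)"] bexI[of _ "?r (c n)"])
        (simp_all add: generalised_derivation_power_rank_one r0 rank_one_in_ideal b c)
  qed
  then show ?thesis
    by (simp add: J.mixing_targets_def rank_one_in_ideal f)
qed

text \<open>
  The approximating functionals are \<open>B_n (V) g\<close> and \<open>C_n (V) g\<close> for the series of
  \<open>exp_power_transfer\<close>, which need to converge only up to the coefficient of \<open>X^(2j - 1)\<close> because
  \<open>V^(2j) g = V^j f = 0\<close>.
\<close>

lemma rank_one_kernel_range_mixing: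
  fixes T A :: "'a \<Rightarrow>\<^sub>L 'a" and E :: "real fps"
  defines "V \<equiv> (dual_adjoint T :: ('a \<Rightarrow>\<^sub>L 'k) \<Rightarrow> _)"
  assumes T: "T \<in> operators smul" and A: "A \<in> operators smul"
    and E: "E = fps_exp 1 oo L" "fps_nth L 0 = 0" "fps_nth L 1 \<noteq> 0"
    and act: "\<And>m h. (V ^^ m) h = 0 \<Longrightarrow> h + dual_adjoint A h = fps_act V m E h"
    and g: "g \<in> dual smul" and f: "f = (V ^^ j) g" "(V ^^ j) f = 0"
  shows "rank_one smul f x \<in> J.mixing_targets (generalised_derivation id_blinfun (- A))"
proof -
  let ?W = "\<lambda>h. h + dual_adjoint A h"
  define m where "m = 2 * j"
  have V: "linear V" unfolding V_def by (rule linear_dual_adjoint)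
  have gm: "(V ^^ m) g = 0"
    using f by (simp add: m_def mult_2 funpow_add)
  have fX: "fps_act V m (fps_X ^ j) g = f"
  proof (cases "j = 0")
    case True
    \<comment> \<open>Here \<open>m = 0\<close>, so series act as zero; but also \<open>f = V^0 f = 0\<close>.\<close>
    then show ?thesis using f by (simp add: m_def fps_act_def)
  qed (simp add: m_def fps_act_X_power f)
  have act_dual: "fps_act V m F g \<in> dual smul" for F
    unfolding V_def by (rule fps_act_in_dual[OF T g])
  have W: "(?W ^^ n) (fps_act V m F g) = fps_act V m (E ^ n * F) g" for n F
  proof (induction n)
    case (Suc n)
    have "?W (fps_act V m (E ^ n * F) g) = fps_act V m (E * (E ^ n * F)) g"
      unfolding fps_act_mult[OF V gm, of E] by (rule act[OF funpow_fps_act_eq_0[OF V gm]])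
    with Suc show ?case by (simp add: mult.assoc)
  qed simp
  obtain B C where BC: "\<And>l. l < m \<Longrightarrow> (\<lambda>n. fps_nth (B n) l) \<longlonglongrightarrow> 0"
    "\<And>l. l < m \<Longrightarrow> (\<lambda>n. fps_nth (E ^ n * B n) l) \<longlonglongrightarrow> fps_nth (fps_X ^ j) l"
    "\<And>l. l < m \<Longrightarrow> (\<lambda>n. fps_nth (C n) l) \<longlonglongrightarrow> fps_nth (fps_X ^ j) l"
    "\<And>l. l < m \<Longrightarrow> (\<lambda>n. fps_nth (E ^ n * C n) l) \<longlonglongrightarrow> 0"
    unfolding m_def using exp_power_transfer[OF E, of j] by blast
  have act0: "fps_act V m 0 g = 0" by (simp add: fps_act_def)
  show ?thesis
  proof (rule rank_one_in_mixing_targets[OF A])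
    show "f \<in> dual smul" using act_dual[of "fps_X ^ j"] by (simp only: fX)
    show "fps_act V m (B n) g \<in> dual smul" "fps_act V m (C n) g \<in> dual smul" for n
      by (rule act_dual)+
    show "(\<lambda>n. fps_act V m (B n) g) \<longlonglongrightarrow> 0"
      using tendsto_fps_act[of m B 0 V g] BC(1) by (simp add: act0)
    show "(\<lambda>n. fps_act V m (C n) g) \<longlonglongrightarrow> f"
      using tendsto_fps_act[of m C "fps_X ^ j" V g] BC(3) by (simp only: fX)
    show "(\<lambda>n. (?W ^^ n) (fps_act V m (B n) g)) \<longlonglongrightarrow> f"
      unfolding W using tendsto_fps_act[of m "\<lambda>n. E ^ n * B n" "fps_X ^ j" V g] BC(2) by (simp only: fX)
    show "(\<lambda>n. (?W ^^ n) (fps_act V m (C n) g)) \<longlonglongrightarrow> 0"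
      unfolding W using tendsto_fps_act[of m "\<lambda>n. E ^ n * C n" 0 V g] BC(4) by (simp add: act0)
  qed
qed

end

section \<open>The Hypercyclicity Criterion for generalised derivations\<close>

text \<open>
  Density is used twice to see that every member of the ideal is a mixing target: of the span of the
  sets \<open>ker V^j \<inter> ran V^j\<close> in the dual space, and of the finite rank operators in the ideal.
\<close>

lemma hypercyclicity_criterion_fps:
  fixes smul :: "'k::{real_normed_field,banach} \<Rightarrow> 'a::banach \<Rightarrow> 'a"
    and T A :: "'a \<Rightarrow>\<^sub>L 'a" and E :: "real fps"
  defines "V \<equiv> (dual_adjoint T :: ('a \<Rightarrow>\<^sub>L 'k) \<Rightarrow> _)"
  assumes ideal: "admissible_banach_ideal smul J normJ"
    and sep: "separable_space (norm_topology J normJ)"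
    and T: "T \<in> operators smul" and A: "A \<in> operators smul"
    and shift: "extended_backward_shift (map_scale (*)) (dual smul) norm V"
    and E: "E = fps_exp 1 oo L" "fps_nth L 0 = 0" "fps_nth L 1 \<noteq> 0"
    and act: "\<And>m h. (V ^^ m) h = 0 \<Longrightarrow> h + dual_adjoint A h = fps_act V m E h"
  shows "hypercyclicity_criterion (map_scale smul) J normJ (generalised_derivation id_blinfun (- A))"
proof -
  interpret admissible_banach_ideal smul J normJ by fact
  let ?U = "generalised_derivation id_blinfun (- A)"
  have U: "bounded_operator_on (map_scale smul) J normJ ?U"
    by (rule bounded_generalised_derivation[OF A])
  interpret D: banach_space_on "map_scale (*)" "dual smul" norm
    by (rule banach_space_on_dual)
  let ?M = "J.mixing_targets ?U"
  have M: "J.subspace ?M" by (rule J.subspace_mixing_targets[OF U])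
  define K where "K = (\<Union>j. {y \<in> dual smul. (V ^^ j) y = 0} \<inter> (V ^^ j) ` dual smul)"
  define P where "P = {f \<in> dual smul. \<forall>x. rank_one smul f x \<in> ?M}"
  have "D.subspace P"
  proof (rule D.subspaceI)
    show "0 \<in> P"
    proof -
      have "rank_one smul 0 x = 0" for x by (auto intro!: blinfun_eqI)
      then show ?thesis using J.subspace_0[OF M] by (simp add: P_def dual_closed)
    qed
    show "f + g \<in> P" if "f \<in> P" "g \<in> P" for f g
      using that J.subspace_add[OF M] by (simp add: P_def rank_one_add)
    show "map_scale (*) c f \<in> P" if "f \<in> P" for c f
      using that J.subspace_scale[OF M] by (simp add: P_def rank_one_scale)
  qed
  moreover have "K \<subseteq> P"
    unfolding K_def P_def
    using rank_one_kernel_range_mixing[OF T A E act[unfolded V_def]] unfolding V_def by blast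
  ultimately have span: "D.span K \<subseteq> P"
    by (intro D.span_minimal)
  have dense: "norm_topology (dual smul) norm closure_of D.span K = dual smul"
    using shift by (simp add: extended_backward_shift_def K_def)
  have rank_one: "rank_one smul f x \<in> ?M" if f: "f \<in> dual smul" for f x
  proof (rule J.mixing_targets_closed[OF U rank_one_in_ideal[OF f]])
    fix e :: real assume "e > 0"
    have pos: "norm x + 1 > 0" by (simp add: add_nonneg_pos)
    have "D.span K \<subseteq> dual smul" using span by (auto simp: P_def)
    then obtain h where h: "h \<in> D.span K" "norm (h - f) < e / (norm x + 1)"
      using dense D.closure_of_eq_carrier_iff f divide_pos_pos[OF \<open>e > 0\<close> pos] by blast
    then have hP: "h \<in> P" using span by blast
    have "normJ (rank_one smul h x - rank_one smul f x) = norm (h - f) * norm x"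
      using hP f by (simp flip: rank_one_diff add: normJ_rank_one P_def)
    also have "\<dots> \<le> norm (h - f) * (norm x + 1)" by (simp add: mult_left_mono)
    also have "\<dots> < e" using h(2) pos by (simp add: field_simps)
    finally show "\<exists>z\<in>?M. normJ (z - rank_one smul f x) < e"
      using hP by (auto simp: P_def)
  qed
  have finite_rank: "finite_rank_operators smul \<subseteq> ?M"
    unfolding finite_rank_operators_def using rank_one by (intro J.span_minimal M) auto
  have "?M \<subseteq> J" by (auto simp: J.mixing_targets_def)
  moreover have "J \<subseteq> ?M"
  proof
    fix S assume S: "S \<in> J"
    have "\<exists>z\<in>?M. normJ (z - S) < e" if "e > 0" for e
      using finite_rank_dense J.closure_of_eq_carrier_iff[of "finite_rank_operators smul"]
        finite_rank \<open>?M \<subseteq> J\<close> S that by blast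
    then show "S \<in> ?M" by (rule J.mixing_targets_closed[OF U S])
  qed
  ultimately show ?thesis
    by (intro J.mixing_imp_hypercyclicity_criterion[OF U _ sep]) blast
qed

theorem theorem2p4:
  fixes smul :: "'k::{real_normed_field,banach} \<Rightarrow> 'a::banach \<Rightarrow> 'a"
    and J :: "('a \<Rightarrow>\<^sub>L 'a) set" and normJ :: "('a \<Rightarrow>\<^sub>L 'a) \<Rightarrow> real"
    and T :: "'a \<Rightarrow>\<^sub>L 'a"
  assumes "scalar_banach_space smul"
    and "admissible_banach_ideal smul J normJ"
    and "separable_space (norm_topology J normJ)"
    and "T \<in> operators smul"
    and "extended_backward_shift (map_scale (*)) (dual smul) norm
           (dual_adjoint T :: ('a \<Rightarrow>\<^sub>L 'k) \<Rightarrow> ('a \<Rightarrow>\<^sub>L 'k))"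
  shows "hypercyclicity_criterion (map_scale smul) J normJ
           (generalised_derivation id_blinfun (- T))
       \<and> hypercyclicity_criterion (map_scale smul) J normJ
           (generalised_derivation id_blinfun
             (- (\<Sum>j. (1 / fact (Suc j)) *\<^sub>R blinfun_pow T (Suc j))))"
proof -
  interpret scalar_banach_space smul by fact
  show ?thesis
  proof
    show "hypercyclicity_criterion (map_scale smul) J normJ (generalised_derivation id_blinfun (- T))"
      by (rule hypercyclicity_criterion_fps[OF assms(2,3,4,4,5) one_plus_X_eq_exp_ln])
        (simp_all add: fps_ln_nth one_plus_adjoint_eq_fps_act)
    show "hypercyclicity_criterion (map_scale smul) J normJ
        (generalised_derivation id_blinfun (- (\<Sum>j. (1 / fact (Suc j)) *\<^sub>R blinfun_pow T (Suc j))))"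
      by (rule hypercyclicity_criterion_fps[OF assms(2,3,4) power_sum_in_operators[OF assms(4)] assms(5),
            where L = fps_X and E = "fps_exp 1"])
        (simp_all only: fps_compose_fps_X exp_adjoint_eq_fps_act, simp_all)
  qed
qed

end
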